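(* Let $\mathcal{V}$ be a primitive $4$-dimensional subspace of $\mathrm{M}_{n,p}(\mathbb{F}_2)$. Assume that $\mathcal{V}$ is a rank-$2$ space, i.e. all its non-zero matrices have rank $2$. Then $\mathcal{V}$ is equivalent to $\mathcal{V}_3(\mathbb{F}_2)$ (in particular $n=p=3$).
   Context: $n,p$ are non-negative integers. $\mathrm{M}_{n,p}(\mathbb{K})$ is the space of $n\times p$ matrices over a field $\mathbb{K}$. The upper rank $\operatorname{urk}(\mathcal{V})$ of a linear subspace $\mathcal{V}$ of $\mathrm{M}_{n,p}(\mathbb{K})$ is the maximal rank of a matrix in $\mathcal{V}$. Two linear subspaces $\mathcal{V}_1,\mathcal{V}_2$ of $\mathrm{M}_{n,p}(\mathbb{K})$ are equivalent when $\mathcal{V}_2=P\mathcal{V}_1Q$ for some $P\in\mathrm{GL}_n(\mathbb{K})$, $Q\in\mathrm{GL}_p(\mathbb{K})$. A linear subspace $\mathcal{V}$ of $\mathrm{M}_{n,p}(\mathbb{K})$ with upper rank $r$ is called primitive when: (i) no non-zero vector of $\mathbb{K}^p$ belongs to the kernel of every matrix of $\mathcal{V}$; (ii) the span of the ranges of all the matrices of $\mathcal{V}$ is $\mathbb{K}^n$; (iii) $\mathcal{V}$ is not equivalent to a space $\mathcal{T}$ of matrices of the form $M=\begin{bmatrix} H(M) & [?]_{n\times 1}\end{bmatrix}$ (so $H(M)\in\mathrm{M}_{n,p-1}(\mathbb{K})$) where $\operatorname{urk}H(\mathcal{T})\leq r-1$; (iv) $\mathcal{V}$ is not equivalent to a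 space $\mathcal{T}$ of matrices of the form $M=\begin{bmatrix} H(M)\\ [?]_{1\times p}\end{bmatrix}$ (so $H(M)\in\mathrm{M}_{n-1,p}(\mathbb{K})$) where $\operatorname{urk}H(\mathcal{T})\leq r-1$. $$\mathcal{V}_3(\mathbb{F}_2)=\left\{\begin{bmatrix}0&a&c+d\\ c&0&b\\ a+b&d&0\end{bmatrix} \mid (a,b,c,d)\in\mathbb{F}_2^4\right\}\subset \mathrm{M}_3(\mathbb{F}_2).$$ *)

theory Defs
  imports
    "Jordan_Normal_Form.DL_Rank"
    "Jordan_Normal_Form.Matrix_Kernel"
    "HOL-Library.Z2"
begin

text \<open>The field with two elements is the type \<^typ>\<open>bit\<close>.  Matrices are those of
  \<^theory>\<open>Jordan_Normal_Form.Matrix\<close>, so that the sizes \<open>n\<close> and \<open>p\<close> are ordinary natural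
  numbers, possibly zero.\<close>

definition mat_subspace :: "nat \<Rightarrow> nat \<Rightarrow> 'a::field mat set \<Rightarrow> bool" where
  "mat_subspace n p V \<longleftrightarrow> VectorSpace.subspace class_ring V (module_mat TYPE('a) n p)"

definition mat_subspace_dim :: "nat \<Rightarrow> nat \<Rightarrow> 'a::field mat set \<Rightarrow> nat" where
  "mat_subspace_dim n p V =
     vectorspace.dim class_ring ((module_mat TYPE('a) n p)\<lparr>carrier := V\<rparr>)"

text \<open>The rank of a matrix with \<open>n\<close> rows is \<^term>\<open>vec_space.rank n\<close>.  The set of ranks below is
  finite, since the rank of an \<open>n \<times> p\<close> matrix is at most \<open>p\<close>.\<close>

definition upper_rank :: "nat \<Rightarrow> 'a::field mat set \<Rightarrow> nat" where
  "upper_rank n V = Max (vec_space.rank n ` V)"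

definition GL :: "nat \<Rightarrow> 'a::field mat set" where
  "GL n = {P \<in> carrier_mat n n. invertible_mat P}"

definition equivalent_spaces ::
    "nat \<Rightarrow> nat \<Rightarrow> 'a::field mat set \<Rightarrow> 'a mat set \<Rightarrow> bool" where
  "equivalent_spaces n p V W \<longleftrightarrow>
     (\<exists>P \<in> GL n. \<exists>Q \<in> GL p. W = (\<lambda>M. P * M * Q) ` V)"

definition drop_last_col :: "'a mat \<Rightarrow> 'a mat" where
  "drop_last_col M = mat (dim_row M) (dim_col M - 1) (\<lambda>(i, j). M $$ (i, j))"

definition drop_last_row :: "'a mat \<Rightarrow> 'a mat" where
  "drop_last_row M = mat (dim_row M - 1) (dim_col M) (\<lambda>(i, j). M $$ (i, j))"

text \<open>In the last two conditions a matrix has a last column (row) to split off only if \<open>p > 0\<close>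
  (\<open>n > 0\<close>).  The bound \<open>\<le> r - 1\<close>, with \<open>r\<close> the upper rank of \<open>V\<close>, is written \<open>< r\<close>, so
  that it is unsatisfiable for \<open>r = 0\<close> instead of being affected by truncated subtraction.\<close>

definition primitive_space :: "nat \<Rightarrow> nat \<Rightarrow> 'a::field mat set \<Rightarrow> bool" where
  "primitive_space n p V \<longleftrightarrow>
     mat_subspace n p V \<and>
     \<not> (\<exists>x \<in> carrier_vec p. x \<noteq> 0\<^sub>v p \<and> (\<forall>M \<in> V. x \<in> mat_kernel M)) \<and>
     LinearCombinations.module.span class_ring (module_vec TYPE('a) n)
       (\<Union>M \<in> V. (\<lambda>x. M *\<^sub>v x) ` carrier_vec p) = carrier_vec n \<and>
     \<not> (p > 0 \<and> (\<exists>T. equivalent_spaces n p V T \<and>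
          upper_rank n (drop_last_col ` T) < upper_rank n V)) \<and>
     \<not> (n > 0 \<and> (\<exists>T. equivalent_spaces n p V T \<and>
          upper_rank (n - 1) (drop_last_row ` T) < upper_rank n V))"

definition V3_F2 :: "bit mat set" where
  "V3_F2 = {mat_of_rows_list 3
      [[0,     a, c + d],
       [c,     0, b    ],
       [a + b, d, 0    ]] | a b c d. True}"

end

theory Submission
  imports Defs "HOL-Library.Function_Algebras"
begin

text \<open>
Regard the matrices as bilinear forms \<open>C y x\<close>.  Rank at most \<open>2\<close> means that all minors of order \<open>3\<close>
vanish.  Over a large field the vanishing of a minor on a pencil \<open>s A + t B\<close> is an identity of
polynomials in \<open>s\<close> and \<open>t\<close>, but over two elements it is not, the only failure being the polynomial
\<open>s t (s + t)\<close>.  The proof distinguishes whether this failure occurs.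

If it does not, then \<open>B\<close> maps the kernel of \<open>A\<close> into the image of \<open>A\<close> for all members \<open>A \<noteq> 0\<close> and
\<open>B\<close>, and the argument for large fields applies: writing the members in block form with respect to
one \<open>A\<close> of rank \<open>2\<close>, either there is a hyperplane on which all members have rank at most \<open>1\<close>, or the
same holds after transposition, or the dimension is at most \<open>3\<close> as for alternating matrices
(\<open>collapses_or_dual\<close>).  In dimension \<open>4\<close> this contradicts primitivity (\<open>not_collapses_cols\<close>,
\<open>not_collapses_rows\<close>).

If it does, then the space contains the pencil \<open>diag (s, t, s + t)\<close> in suitable bases
(\<open>diag_frame_of_kernels\<close>).  Adding this pencil to an arbitrary member and comparing coefficients of
\<open>s t\<close> in minors, one finds that the member vanishes outside the three rows and columns of the pencil
(\<open>expand_left\<close>), and primitivity gives \<open>n = p = 3\<close>.  Modulo the pencil, a member is a matrix with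
zero diagonal, that is, a directed graph on three vertices, and only thirteen non-empty graphs are
compatible with the rank conditions.  The three non-zero classes modulo the pencil are therefore
either the three paths of a directed cycle, or a transitive tournament, its opposite and the
complete graph (\<open>V3_frame_of_chain\<close>).  In both cases an explicit change of basis leads to
\<^const>\<open>V3_F2\<close>.
\<close>

section \<open>Forms over the field with two elements\<close>

text \<open>An identity between polynomials in bits is a propositional statement about the parities of the
atoms; these equations perform the translation.\<close>

lemmas bit_prop = Z2.bit_eq_iff even_add even_mult_iff even_zero odd_one

lemma bit_add_self: "(a::bit) + a = 0"
  by (cases a) simp_all

text \<open>Over two elements an additive map is linear, so vectors only need to form a commutative monoid.
Multiplying by a scalar then means keeping a vector or replacing it by zero.\<close>

definition scale :: "bit \<Rightarrow> 'a::zero \<Rightarrow> 'a" (infixr "\<odot>" 75) where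
  "a \<odot> v = (if a = 1 then v else 0)"

definition minor2 :: "('a \<Rightarrow> 'b \<Rightarrow> bit) \<Rightarrow> 'a \<Rightarrow> 'a \<Rightarrow> 'b \<Rightarrow> 'b \<Rightarrow> bit" where
  "minor2 C y1 y2 x1 x2 = C y1 x1 * C y2 x2 + C y1 x2 * C y2 x1"

definition minor3 :: "('a \<Rightarrow> 'b \<Rightarrow> bit) \<Rightarrow> 'a \<Rightarrow> 'a \<Rightarrow> 'a \<Rightarrow> 'b \<Rightarrow> 'b \<Rightarrow> 'b \<Rightarrow> bit" where
  "minor3 C y1 y2 y3 x1 x2 x3 =
     C y1 x1 * (C y2 x2 * C y3 x3 + C y2 x3 * C y3 x2) +
     C y1 x2 * (C y2 x1 * C y3 x3 + C y2 x3 * C y3 x1) +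
     C y1 x3 * (C y2 x1 * C y3 x2 + C y2 x2 * C y3 x1)"

definition frame :: "('a \<Rightarrow> 'b \<Rightarrow> bit) \<Rightarrow> 'a \<Rightarrow> 'a \<Rightarrow> 'b \<Rightarrow> 'b \<Rightarrow> bool" where
  "frame A u1 u2 v1 v2 \<longleftrightarrow> A u1 v1 = 1 \<and> A u1 v2 = 0 \<and> A u2 v1 = 0 \<and> A u2 v2 = 1"

text \<open>On the three vectors on either side, \<open>s A + t B\<close> is the matrix \<open>diag (s, t, s + t)\<close>.  Its
determinant \<open>s t (s + t)\<close> vanishes for all values of \<open>s\<close> and \<open>t\<close> in the field with two elements,
although it is not the zero polynomial.\<close>

definition diag_frame ::
    "('a \<Rightarrow> 'b \<Rightarrow> bit) \<Rightarrow> ('a \<Rightarrow> 'b \<Rightarrow> bit) \<Rightarrow> 'a \<Rightarrow> 'a \<Rightarrow> 'a \<Rightarrow> 'b \<Rightarrow> 'b \<Rightarrow> 'b \<Rightarrow> bool" where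
  "diag_frame A B y1 y2 y3 x1 x2 x3 \<longleftrightarrow>
     A y1 x1 = 1 \<and> A y1 x2 = 0 \<and> A y1 x3 = 0 \<and>
     A y2 x1 = 0 \<and> A y2 x2 = 0 \<and> A y2 x3 = 0 \<and>
     A y3 x1 = 0 \<and> A y3 x2 = 0 \<and> A y3 x3 = 1 \<and>
     B y1 x1 = 0 \<and> B y1 x2 = 0 \<and> B y1 x3 = 0 \<and>
     B y2 x1 = 0 \<and> B y2 x2 = 1 \<and> B y2 x3 = 0 \<and>
     B y3 x1 = 0 \<and> B y3 x2 = 0 \<and> B y3 x3 = 1"

text \<open>The spaces of bilinear forms that arise from four-dimensional spaces of matrices all of whose
non-zero members have rank \<open>2\<close>.  Rank at most \<open>2\<close> is the vanishing of all minors of order \<open>3\<close>, rank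
at least \<open>2\<close> the existence of a minor of order \<open>2\<close>; both are stated for arbitrary vectors, so that
no basis has to be chosen.  The last condition says that three elements never span the space.\<close>

locale rank2_forms =
  fixes V :: "('a::comm_monoid_add \<Rightarrow> 'b::comm_monoid_add \<Rightarrow> bit) set"
  assumes zero_mem: "0 \<in> V"
    and add_left: "C \<in> V \<Longrightarrow> C (y + z) x = C y x + C z x"
    and add_right: "C \<in> V \<Longrightarrow> C y (x + w) = C y x + C y w"
    and add_closed: "C \<in> V \<Longrightarrow> D \<in> V \<Longrightarrow> C + D \<in> V"
    and minor3_zero: "C \<in> V \<Longrightarrow> minor3 C y1 y2 y3 x1 x2 x3 = 0"
    and minor2_one: "C \<in> V \<Longrightarrow> C \<noteq> 0 \<Longrightarrow> \<exists>y1 y2 x1 x2. minor2 C y1 y2 x1 x2 = 1"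
    and large: "A \<in> V \<Longrightarrow> B \<in> V \<Longrightarrow> D \<in> V \<Longrightarrow>
      \<exists>C\<in>V. C \<notin> {0, A, B, A + B, D, A + D, B + D, A + B + D}"
begin

lemma zero_left: "C \<in> V \<Longrightarrow> C 0 x = 0"
  using add_left[of C 0 0 x] by (simp add: bit_add_self)

lemma zero_right: "C \<in> V \<Longrightarrow> C y 0 = 0"
  using add_right[of C y 0 0] by (simp add: bit_add_self)

lemma scale_left: "C \<in> V \<Longrightarrow> C (a \<odot> y) x = a * C y x"
  by (cases a) (simp_all add: scale_def zero_left)

lemma scale_right: "C \<in> V \<Longrightarrow> C y (a \<odot> x) = a * C y x"
  by (cases a) (simp_all add: scale_def zero_right)

lemmas evaluate = add_left add_right scale_left scale_right

text \<open>Transposition: every statement below has a mirror image with rows and columns exchanged.\<close>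

lemma dual: "rank2_forms ((\<lambda>C x y. C y x) ` V)"
proof unfold_locales
  let ?t = "\<lambda>(C :: 'a \<Rightarrow> 'b \<Rightarrow> bit) x y. C y x"
  have sum: "?t C + ?t D = ?t (C + D)" for C D by (simp add: fun_eq_iff)
  have "?t 0 = 0" by (simp add: fun_eq_iff)
  then show "0 \<in> ?t ` V" using zero_mem by (metis image_eqI)
  fix C D assume C: "C \<in> ?t ` V" and D: "D \<in> ?t ` V"
  then obtain C' D' where C': "C' \<in> V" "C = ?t C'" and D': "D' \<in> V" "D = ?t D'" by blast
  show "C (y + z) x = C y x + C z x" for y z x using C' add_right by simp
  show "C y (x + w) = C y x + C y w" for y x w using C' add_left by simp
  show "C + D \<in> ?t ` V" using C' D' add_closed[of C' D'] sum by blast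
  show "minor3 C y1 y2 y3 x1 x2 x3 = 0" for y1 y2 y3 x1 x2 x3
    using minor3_zero[OF C'(1), of x1 x2 x3 y1 y2 y3]
    unfolding minor3_def C'(2) by (simp only: bit_prop; satx)
  show "\<exists>y1 y2 x1 x2. minor2 C y1 y2 x1 x2 = 1" if "C \<noteq> 0"
  proof -
    have "C' \<noteq> 0" using that C'(2) by (auto simp: fun_eq_iff)
    then obtain y1 y2 x1 x2 where "minor2 C' y1 y2 x1 x2 = 1" using minor2_one C'(1) by blast
    then have "minor2 C x1 x2 y1 y2 = 1" unfolding minor2_def C'(2) by (simp only: bit_prop; satx)
    then show ?thesis by blast
  qed
next
  let ?t = "\<lambda>(C :: 'a \<Rightarrow> 'b \<Rightarrow> bit) x y. C y x"
  fix A B D assume "A \<in> ?t ` V" "B \<in> ?t ` V" "D \<in> ?t ` V"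
  then obtain A' B' D' where *: "A' \<in> V" "B' \<in> V" "D' \<in> V" "A = ?t A'" "B = ?t B'" "D = ?t D'"
    by blast
  obtain C where C: "C \<in> V" "C \<notin> {0, A', B', A' + B', D', A' + D', B' + D', A' + B' + D'}"
    using large *(1-3) by blast
  have "inj ?t" by (auto intro!: injI simp: fun_eq_iff)
  then have "?t C \<notin> ?t ` S" if "C \<notin> S" for S
    using that by (metis inj_image_mem_iff)
  then have "?t C \<notin> ?t ` {0, A', B', A' + B', D', A' + D', B' + D', A' + B' + D'}"
    using C(2) by blast
  also have "?t ` {0, A', B', A' + B', D', A' + D', B' + D', A' + B' + D'} =
      {0, A, B, A + B, D, A + D, B + D, A + B + D}"
    unfolding *(4-6) by (simp add: plus_fun_def zero_fun_def)
  finally have "?t C \<notin> {0, A, B, A + B, D, A + D, B + D, A + B + D}" .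
  then show "\<exists>C\<in>?t ` V. C \<notin> {0, A, B, A + B, D, A + D, B + D, A + B + D}" using C(1) by blast
qed

section \<open>The exceptional pencil\<close>

text \<open>Multiplying the two rows of a non-singular minor by its adjugate turns it into the identity.\<close>

lemma frame_exists:
  assumes "A \<in> V" "A \<noteq> 0"
  obtains u1 u2 v1 v2 where "frame A u1 u2 v1 v2"
proof -
  obtain u1 u2 v1 v2 where m: "minor2 A u1 u2 v1 v2 = 1" using minor2_one assms by blast
  have "frame A (A u2 v2 \<odot> u1 + A u1 v2 \<odot> u2) (A u2 v1 \<odot> u1 + A u1 v1 \<odot> u2) v1 v2"
    using m unfolding frame_def minor2_def evaluate[OF assms(1)] by (simp only: bit_prop; satx)
  then show thesis by (rule that)
qed

text \<open>\<open>K\<close>, the matrix of \<open>B\<close> on the frame, is triangular and idempotent here, and the new vectors are its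
eigenvectors.\<close>

lemma diag_frame_of_frame:
  assumes A: "A \<in> V" and B: "B \<in> V" and fr: "frame A u1 u2 v1 v2"
    and y: "\<And>x'. A y x' = 0" and x: "\<And>y'. A y' x = 0" and yx: "B y x = 1"
    and border: "B u1 x = 0" "B u2 x = 0" "B y v1 = 0" "B y v2 = 0"
    and K: "B u1 v1 = 1" "B u2 v2 = 0" "B u1 v2 = 0 \<or> B u2 v1 = 0"
  shows "diag_frame A B (u2 + B u2 v1 \<odot> u1) y (u1 + B u1 v2 \<odot> u2)
    (v2 + B u1 v2 \<odot> v1) x (v1 + B u2 v1 \<odot> v2)"
  using fr y x yx border K unfolding diag_frame_def frame_def evaluate[OF A] evaluate[OF B]
  by (simp only: bit_prop; satx)

text \<open>Assume that \<open>B\<close> maps some \<open>x\<close> of the right kernel of \<open>A\<close> outside the image of \<open>A\<close>.  After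
clearing the last row and column, \<open>A\<close> and \<open>B\<close> become \<open>diag (I, 0)\<close> and \<open>diag (K, 1)\<close>.  Since \<open>B\<close>
and \<open>A + B\<close> have rank at most \<open>2\<close>, both \<open>K\<close> and \<open>K + I\<close> are singular, so \<open>K\<close> has the
eigenvalues \<open>0\<close> and \<open>1\<close> and can be diagonalised.\<close>

lemma diag_frame_of_kernels:
  assumes A: "A \<in> V" and B: "B \<in> V" and A0: "A \<noteq> 0"
    and y: "\<And>x'. A y x' = 0" and x: "\<And>y'. A y' x = 0" and yx: "B y x = 1"
  shows "\<exists>y1 y2 y3 x1 x2 x3. diag_frame A B y1 y2 y3 x1 x2 x3"
proof -
  obtain u1 u2 v1 v2 where fr: "frame A u1 u2 v1 v2" using frame_exists A A0 by blast
  define s1 s2 t1 t2 where "s1 = u1 + B u1 x \<odot> y" and "s2 = u2 + B u2 x \<odot> y"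
    and "t1 = v1 + B y v1 \<odot> x" and "t2 = v2 + B y v2 \<odot> x"
  note st = s1_def s2_def t1_def t2_def
  have fr': "frame A s1 s2 t1 t2"
    using fr unfolding frame_def st evaluate[OF A] by (simp add: y x)
  have border: "B s1 x = 0" "B s2 x = 0" "B y t1 = 0" "B y t2 = 0"
    unfolding st evaluate[OF B] by (simp_all add: yx bit_add_self)
  have "B s1 t1 * B s2 t2 = B s1 t2 * B s2 t1"
    using minor3_zero[OF B, of s1 s2 y t1 t2 x] border yx unfolding minor3_def
    by (simp only: bit_prop; satx)
  moreover have "(B s1 t1 + 1) * (B s2 t2 + 1) = B s1 t2 * B s2 t1"
    using minor3_zero[OF add_closed[OF A B], of s1 s2 y t1 t2 x] border yx fr' y[of x] y[of t1] y[of t2]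
    x[of s1] x[of s2]
    unfolding minor3_def frame_def plus_fun_apply
    by (simp only: bit_prop; satx)
  ultimately consider "B s1 t1 = 1" "B s2 t2 = 0" "B s1 t2 = 0 \<or> B s2 t1 = 0"
    | "B s2 t2 = 1" "B s1 t1 = 0" "B s2 t1 = 0 \<or> B s1 t2 = 0"
    by (simp only: bit_prop; satx)
  then show ?thesis
  proof cases
    case 1
    show ?thesis using diag_frame_of_frame[OF A B fr' y x yx border 1] by blast
  next
    case 2
    have "frame A s2 s1 t2 t1" using fr' unfolding frame_def by simp
    then show ?thesis
      using diag_frame_of_frame[OF A B _ y x yx border(2) border(1) border(4) border(3) 2] by blast
  qed
qed

text \<open>\<open>A\<close>, \<open>B\<close> and \<open>A + B\<close> have rank \<open>2\<close> already on the frame, so bordering minors show that a vector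
which is orthogonal to the frame in this sense lies in the left kernels of both.\<close>

lemma left_residual_zero:
  assumes A: "A \<in> V" and B: "B \<in> V" and d: "diag_frame A B y1 y2 y3 x1 x2 x3"
    and y: "A y x1 = 0" "B y x2 = 0" "A y x3 = 0"
  shows "A y x = 0" "B y x = 0"
proof -
  show "A y x = 0" for x
    using minor3_zero[OF A, of y1 y3 y x1 x3 x] d y
    unfolding minor3_def diag_frame_def by simp
  then have y2: "A y x2 = 0" .
  have "B y x1 = 0"
    using minor3_zero[OF B, of y2 y3 y x2 x3 x1] d y
    unfolding minor3_def diag_frame_def by simp
  moreover have "B y x3 = 0"
    using minor3_zero[OF add_closed[OF A B], of y1 y2 y x1 x2 x3] d y y2 calculation
    unfolding minor3_def diag_frame_def by simp
  ultimately show "B y x = 0"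
    using minor3_zero[OF B, of y2 y3 y x2 x3 x] d y
    unfolding minor3_def diag_frame_def by simp
qed

text \<open>For fixed \<open>C\<close>, a minor of \<open>C + s A + t B\<close> is a polynomial in \<open>s\<close> and \<open>t\<close> that vanishes at all four
points of the plane over the field with two elements.  Reduced by \<open>s\<^sup>2 = s\<close> and \<open>t\<^sup>2 = t\<close>, it has only
zero coefficients; the statements derived from this lemma are such coefficients.\<close>

lemma diag_frame_minor:
  assumes A: "A \<in> V" and B: "B \<in> V" and C: "C \<in> V"
  shows "minor3 C y1 y2 y3 x1 x2 x3 = 0" "minor3 (C + A) y1 y2 y3 x1 x2 x3 = 0"
    "minor3 (C + B) y1 y2 y3 x1 x2 x3 = 0" "minor3 (C + A + B) y1 y2 y3 x1 x2 x3 = 0"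
  by (intro minor3_zero add_closed assms)+

text \<open>Everything outside the frame vanishes.  For a vector \<open>y'\<close> of the left kernels and \<open>x'\<close> of the right
kernels of \<open>A\<close> and \<open>B\<close>, the coefficient of \<open>s t\<close> in suitable minors of \<open>C + s A + t B\<close> is first
\<open>C y' x'\<close> and then each \<open>C y' x\<^sub>i\<close>.  Hence \<open>y'\<close> lies in the left kernel of every \<open>C\<close>, and every
vector agrees with a combination of the three rows of the frame.\<close>

lemma expand_left:
  assumes A: "A \<in> V" and B: "B \<in> V" and C: "C \<in> V"
    and d: "diag_frame A B y1 y2 y3 x1 x2 x3"
  shows "C y x = A y x1 * C y1 x + B y x2 * C y2 x + A y x3 * C y3 x"
proof -
  define y' where "y' = y + A y x1 \<odot> y1 + B y x2 \<odot> y2 + A y x3 \<odot> y3"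
  define x' where "x' = x + A y1 x \<odot> x1 + B y2 x \<odot> x2 + A y3 x \<odot> x3"
  interpret dual: rank2_forms "(\<lambda>C x y. C y x) ` V" by (rule dual)
  have y0: "A y' x1 = 0" "B y' x2 = 0" "A y' x3 = 0"
    using d unfolding y'_def diag_frame_def by (simp_all add: evaluate A B bit_add_self)
  have x0: "A y1 x' = 0" "B y2 x' = 0" "A y3 x' = 0"
    using d unfolding x'_def diag_frame_def by (simp_all add: evaluate A B bit_add_self)
  note y'0 = left_residual_zero[OF A B d y0]
  have d': "diag_frame (\<lambda>x y. A y x) (\<lambda>x y. B y x) x1 x2 x3 y1 y2 y3"
    using d unfolding diag_frame_def by simp
  have x'0: "A z x' = 0" "B z x' = 0" for z
    using dual.left_residual_zero[OF _ _ d', of x' z] A B x0 by auto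
  note m = diag_frame_minor[OF A B C] 
  have N: "C y' x' = 0"
    using m[of y1 y2 y' x1 x2 x'] d
    unfolding minor3_def diag_frame_def
    by (simp only: y'0 x'0 plus_fun_apply bit_prop mult_zero_left mult_zero_right; satx)
  have M3: "C y' x3 = 0"
    using m[of y1 y2 y' x1 x2 x3] d
    unfolding minor3_def diag_frame_def
    by (simp only: y'0 x'0 plus_fun_apply bit_prop mult_zero_left mult_zero_right; satx)
  have M2: "C y' x2 = 0"
    using m[of y1 y3 y' x1 x3 x2] d
    unfolding minor3_def diag_frame_def
    by (simp only: y'0 x'0 plus_fun_apply bit_prop mult_zero_left mult_zero_right; satx)
  have M1: "C y' x1 = 0"
    using m[of y2 y3 y' x2 x3 x1] d
    unfolding minor3_def diag_frame_def
    by (simp only: y'0 x'0 plus_fun_apply bit_prop mult_zero_left mult_zero_right; satx)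
  have "C y' x' = C y' x + A y1 x * C y' x1 + B y2 x * C y' x2 + A y3 x * C y' x3"
    unfolding x'_def by (simp add: evaluate C)
  then have "C y' x = 0" using N M1 M2 M3 by simp
  moreover have "C y' x = C y x + A y x1 * C y1 x + B y x2 * C y2 x + A y x3 * C y3 x"
    unfolding y'_def by (simp add: evaluate C)
  ultimately show ?thesis by (simp only: bit_prop) argo
qed

text \<open>The coefficient of \<open>s t\<close> in the determinant on the frame is the trace.\<close>

lemma trace_zero:
  assumes A: "A \<in> V" and B: "B \<in> V" and C: "C \<in> V"
    and d: "diag_frame A B y1 y2 y3 x1 x2 x3"
  shows "C y3 x3 = C y1 x1 + C y2 x2"
  using diag_frame_minor[OF A B C, of y1 y2 y3 x1 x2 x3] d
  unfolding minor3_def diag_frame_def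
  by (simp only: plus_fun_apply bit_prop; satx)

end

section \<open>Spaces without the exceptional pencil\<close>

lemma form_add_move: "(C :: 'a \<Rightarrow> 'b \<Rightarrow> bit) + D = E \<longleftrightarrow> C = E + D"
proof -
  have "C + D + D = C" for C :: "'a \<Rightarrow> 'b \<Rightarrow> bit"
    by (simp add: fun_eq_iff add.assoc bit_add_self)
  then show ?thesis by metis
qed

lemma minor2_product:
  assumes "\<And>y x. C y x = f y * g x"
  shows "minor2 C y y' x x' = 0"
  unfolding minor2_def assms by (simp only: bit_prop; satx)

text \<open>Some hyperplane, the kernel of a functional \<open>A u\<close>, on which all forms have rank at most \<open>1\<close>.\<close>

definition collapses :: "('a \<Rightarrow> 'b \<Rightarrow> bit) set \<Rightarrow> bool" where
  "collapses V \<longleftrightarrow> (\<exists>A\<in>V. \<exists>u. (\<exists>x. A u x \<noteq> 0) \<and>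
     (\<forall>C\<in>V. \<forall>y y' x x'. A u x = 0 \<longrightarrow> A u x' = 0 \<longrightarrow> minor2 C y y' x x' = 0))"

text \<open>The situation in which no pencil \<open>diag (s, t, s + t)\<close> occurs: every element maps the kernel of every
other non-zero element into its image, as it would over a large field.\<close>

locale pencil_free = rank2_forms +
  assumes kernels_paired: "A \<in> V \<Longrightarrow> B \<in> V \<Longrightarrow> A \<noteq> 0 \<Longrightarrow> (\<And>x'. A y x' = 0) \<Longrightarrow> (\<And>y'. A y' x = 0)
    \<Longrightarrow> B y x = 0"
begin

lemma pencil_free_dual: "pencil_free ((\<lambda>C x y. C y x) ` V)"
proof -
  interpret dual: rank2_forms "(\<lambda>C x y. C y x) ` V" by (rule dual)
  show ?thesis
  proof unfold_locales
    fix A B y x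
    assume "A \<in> (\<lambda>C x y. C y x) ` V" "B \<in> (\<lambda>C x y. C y x) ` V" "A \<noteq> 0"
      and *: "\<And>x'. A y x' = 0" "\<And>y'. A y' x = 0"
    then obtain A' B' where A': "A' \<in> V" "A = (\<lambda>x y. A' y x)" and B': "B' \<in> V" "B = (\<lambda>x y. B' y x)"
      by blast
    have "A' \<noteq> 0" using \<open>A \<noteq> 0\<close> A'(2) by (auto simp: fun_eq_iff)
    then show "B y x = 0" using kernels_paired[OF A'(1) B'(1), of x y] * A'(2) B'(2) by simp
  qed
qed

end

text \<open>On a frame of \<open>A\<close>, every \<open>B\<close> of the space has a block form: a matrix \<open>K\<close> of size \<open>2\<close> with entries
\<open>B u\<^sub>i v\<^sub>j\<close>, a right border \<open>L\<close> formed by the functionals \<open>B u\<^sub>1\<close> and \<open>B u\<^sub>2\<close> on the right null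
space of \<open>A\<close>, a lower border \<open>M\<close> formed by \<open>B _ v\<^sub>1\<close> and \<open>B _ v\<^sub>2\<close> on the left null space, and a
zero block.\<close>

locale framed = pencil_free +
  fixes A u1 u2 v1 v2
  assumes A: "A \<in> V" and frame: "frame A u1 u2 v1 v2"
begin

lemma A_nonzero: "A \<noteq> 0"
  using frame by (auto simp: frame_def)

definition left_null where "left_null y \<longleftrightarrow> (\<forall>x. A y x = 0)"
definition right_null where "right_null x \<longleftrightarrow> (\<forall>y. A y x = 0)"

lemma A_expand: "A y x = A y v1 * A u1 x + A y v2 * A u2 x"
  using minor3_zero[OF A, of u1 u2 y v1 v2 x] frame unfolding minor3_def frame_def
  by (simp only: bit_prop; satx)

lemma left_null_residual: "left_null (y + A y v1 \<odot> u1 + A y v2 \<odot> u2)"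
  unfolding left_null_def evaluate[OF A]
  by (metis A_expand add.assoc bit_add_self)

lemma right_null_residual: "right_null (x + A u1 x \<odot> v1 + A u2 x \<odot> v2)"
  unfolding right_null_def evaluate[OF A]
  by (metis A_expand add.assoc bit_add_self mult.commute)

lemma null_null: "B \<in> V \<Longrightarrow> left_null y \<Longrightarrow> right_null x \<Longrightarrow> B y x = 0"
  using kernels_paired[OF A _ A_nonzero] by (simp add: left_null_def right_null_def)

text \<open>\<open>M L = 0\<close>: the difference of the bordered minors of \<open>A + B\<close> and of \<open>B\<close>.\<close>

lemma border_orthogonal:
  assumes B: "B \<in> V" and y: "left_null y" and x: "right_null x"
  shows "B y v1 * B u1 x + B y v2 * B u2 x = 0"
  using minor3_zero[OF B, of u1 u2 y v1 v2 x] minor3_zero[OF add_closed[OF B A], of u1 u2 y v1 v2 x]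
    null_null[OF B y x] frame x[unfolded right_null_def, rule_format, of u1]
    x[unfolded right_null_def, rule_format, of u2] x[unfolded right_null_def, rule_format, of y]
    y[unfolded left_null_def, rule_format, of v1] y[unfolded left_null_def, rule_format, of v2]
  unfolding minor3_def frame_def plus_fun_apply
  by (simp only: bit_prop; satx)

text \<open>\<open>M adj(K) L = 0\<close>, which is the bordered minor of \<open>B\<close> itself.\<close>

lemma border_adjugate:
  assumes B: "B \<in> V" and y: "left_null y" and x: "right_null x"
  shows "B y v1 * B u2 v2 * B u1 x + B y v1 * B u1 v2 * B u2 x +
    B y v2 * B u1 v1 * B u2 x + B y v2 * B u2 v1 * B u1 x = 0"
  using minor3_zero[OF B, of u1 u2 y v1 v2 x] null_null[OF B y x]
  unfolding minor3_def by (simp only: bit_prop; satx)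

lemma border_polar:
  assumes B: "B \<in> V" and C: "C \<in> V" and y: "left_null y" and x: "right_null x"
  shows "B y v1 * C u1 x + C y v1 * B u1 x + B y v2 * C u2 x + C y v2 * B u2 x = 0"
  using border_orthogonal[OF B y x] border_orthogonal[OF C y x] border_orthogonal[OF add_closed[OF B C] y x]
  unfolding plus_fun_apply by (simp only: bit_prop; satx)

lemma expand_y:
  assumes B: "B \<in> V" and x: "right_null x"
  shows "B y x = A y v1 * B u1 x + A y v2 * B u2 x"
proof -
  have "B (y + A y v1 \<odot> u1 + A y v2 \<odot> u2) x = 0"
    by (rule null_null[OF B left_null_residual x])
  then show ?thesis unfolding evaluate[OF B] by (simp only: bit_prop; satx)
qed

lemma expand_xy:
  assumes B: "B \<in> V"
  shows "B y x = A y v1 * B u1 (x + A u1 x \<odot> v1 + A u2 x \<odot> v2)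
    + A y v2 * B u2 (x + A u1 x \<odot> v1 + A u2 x \<odot> v2) + A u1 x * B y v1 + A u2 x * B y v2"
  using expand_y[OF B right_null_residual, of y x] unfolding evaluate[OF B]
  by (simp only: bit_prop; satx)

text \<open>If all right borders vanish, only the two columns \<open>v\<^sub>1\<close> and \<open>v\<^sub>2\<close> matter, and the kernel of
\<open>A u\<^sub>1\<close> leaves just one of them.\<close>

lemma collapses_if_rows_zero:
  assumes "\<And>B x. B \<in> V \<Longrightarrow> right_null x \<Longrightarrow> B u1 x = 0 \<and> B u2 x = 0"
  shows "collapses V"
  unfolding collapses_def
proof (intro bexI exI conjI ballI allI impI)
  show "A u1 v1 \<noteq> 0" using frame by (simp add: frame_def)
  fix C y y' x x' assume C: "C \<in> V" and x: "A u1 x = 0" "A u1 x' = 0"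
  have *: "C z w = A u2 w * C z v2" if "A u1 w = 0" for z w
    using expand_xy[OF C, of z w] assms[OF C right_null_residual, of w] that
    by (simp only: bit_prop; satx)
  show "minor2 C y y' x x' = 0"
    unfolding minor2_def *[OF x(1)] *[OF x(2)] by (simp only: bit_prop; satx)
qed (rule A)

end

text \<open>The main case: an element \<open>B\<close> with both borders non-zero.  As \<open>M L = 0\<close>, the frame can be chosen
so that the right border has only its first row and the lower border only its second column.\<close>

locale framed_pair = framed +
  fixes B y0 x0
  assumes B: "B \<in> V" and y0: "left_null y0" and x0: "right_null x0"
    and Bx0: "B u1 x0 = 1" "B u2 x0 = 0" and By0: "B y0 v1 = 0" "B y0 v2 = 1"
begin

lemma B_col: "left_null y \<Longrightarrow> B y v1 = 0"
  using border_orthogonal[OF B _ x0] Bx0 by simp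

lemma B_row: "right_null x \<Longrightarrow> B u2 x = 0"
  using border_orthogonal[OF B y0] By0 by simp

lemma B_corner: "B u2 v1 = 0"
  using border_adjugate[OF B y0 x0] Bx0 By0 by simp

definition unbordered where
  "unbordered C \<longleftrightarrow> (\<forall>y. left_null y \<longrightarrow> C y v1 = 0 \<and> C y v2 = 0) \<and>
     (\<forall>x. right_null x \<longrightarrow> C u1 x = 0 \<and> C u2 x = 0)"

text \<open>Adding \<open>B\<close> supplies the borders that make the relation \<open>M adj(K) L = 0\<close> say something about \<open>K\<close>.\<close>

lemma unbordered_corner:
  assumes C: "C \<in> V" and un: "unbordered C"
  shows "C u2 v1 = 0"
  using border_adjugate[OF add_closed[OF B C] y0 x0] un y0 x0 Bx0 By0 B_corner
  unfolding unbordered_def by simp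

lemma unbordered_expand:
  assumes C: "C \<in> V" and un: "unbordered C"
  shows "C y x = A y v1 * C u1 v1 * A u1 x + A y v1 * C u1 v2 * A u2 x + A y v2 * C u2 v2 * A u2 x"
proof -
  have r: "C z (x + A u1 x \<odot> v1 + A u2 x \<odot> v2) = 0" for z
    using expand_y[OF C right_null_residual, of z x] un right_null_residual
    unfolding unbordered_def by simp
  have l: "C (y + A y v1 \<odot> u1 + A y v2 \<odot> u2) v1 = 0 \<and> C (y + A y v1 \<odot> u1 + A y v2 \<odot> u2) v2 = 0"
    using un left_null_residual unfolding unbordered_def by blast
  show ?thesis using r[of y] l unbordered_corner[OF C un] unfolding evaluate[OF C]
    by (simp only: bit_prop; satx)
qed

lemma unbordered_singular:
  assumes C: "C \<in> V" and un: "unbordered C" and K: "C u1 v1 = 0 \<or> C u2 v2 = 0"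
  shows "C = 0"
proof (rule ccontr)
  assume "C \<noteq> 0"
  then obtain a b c d where m: "minor2 C a b c d = 1" using minor2_one[OF C] by blast
  from K show False
  proof
    assume "C u1 v1 = 0"
    then have "C y x = (A y v1 * C u1 v2 + A y v2 * C u2 v2) * A u2 x" for y x
      using unbordered_expand[OF C un, of y x] by (simp only: bit_prop; satx)
    then have "minor2 C a b c d = 0"
      by (rule minor2_product[where f = "\<lambda>y. A y v1 * C u1 v2 + A y v2 * C u2 v2" and g = "A u2"])
    then show False using m by simp
  next
    assume "C u2 v2 = 0"
    then have "C y x = A y v1 * (C u1 v1 * A u1 x + C u1 v2 * A u2 x)" for y x
      using unbordered_expand[OF C un, of y x] by (simp only: bit_prop; satx)
    then have "minor2 C a b c d = 0"
      by (rule minor2_product[where f = "\<lambda>y. A y v1"])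
    then show False using m by simp
  qed
qed

text \<open>An element without borders is an upper triangular matrix of size \<open>2\<close>.  If it is non-zero it has rank
\<open>2\<close>, so its diagonal is that of \<open>A\<close>; then its sum with \<open>A\<close> has rank at most \<open>1\<close> and must vanish.\<close>

lemma unbordered_cases:
  assumes C: "C \<in> V" and un: "unbordered C"
  shows "C = 0 \<or> C = A"
proof (rule ccontr)
  assume "\<not> (C = 0 \<or> C = A)"
  then have "C \<noteq> 0" "C + A \<noteq> 0" by (simp_all add: form_add_move)
  have un': "unbordered (C + A)"
    using un unfolding unbordered_def left_null_def right_null_def by simp
  have "C u1 v1 = 1" using unbordered_singular[OF C un] \<open>C \<noteq> 0\<close> by auto
  then have "(C + A) u1 v1 = 0" using frame by (simp add: frame_def)
  then show False using unbordered_singular[OF add_closed[OF C A] un'] \<open>C + A \<noteq> 0\<close> by blast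
qed

text \<open>Polarising \<open>M L = 0\<close> between \<open>B\<close> and \<open>C\<close> shows that the two borders of \<open>C\<close> which \<open>B\<close> lacks are
the same multiple \<open>C u\<^sub>2 x\<^sub>0\<close>, its twist, of the borders of \<open>B\<close>.\<close>

lemma twist:
  assumes C: "C \<in> V" 
  shows "left_null y \<Longrightarrow> C y v1 = B y v2 * C u2 x0"
    and "right_null x \<Longrightarrow> C u2 x = B u1 x * C u2 x0"
proof -
  have *: "C y v1 * B u1 x + B y v2 * C u2 x = 0" if "left_null y" "right_null x" for y x
    using border_polar[OF B C that] B_col[OF that(1)] B_row[OF that(2)] by simp
  show col: "C y v1 = B y v2 * C u2 x0" if "left_null y" for y
    using *[OF that x0] Bx0 by (simp only: bit_prop; satx)
  show "C u2 x = B u1 x * C u2 x0" if "right_null x" for x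
    using *[OF y0 that] col[OF y0] By0 by (simp only: bit_prop; satx)
qed

text \<open>With these borders and corners equal to zero, every element maps the kernel of \<open>A u\<^sub>2\<close> into one
line.\<close>

lemma collapses_if_corner_zero:
  assumes tw: "\<And>C. C \<in> V \<Longrightarrow> C u2 x0 = 0" and corner: "\<And>C. C \<in> V \<Longrightarrow> C u2 v1 = 0"
  shows "collapses V"
  unfolding collapses_def
proof (intro bexI exI conjI ballI allI impI)
  show "A u2 v2 \<noteq> 0" using frame by (simp add: frame_def)
  fix C y y' x x' assume C: "C \<in> V" and x: "A u2 x = 0" "A u2 x' = 0"
  have *: "C z w = A z v1 * C u1 w" if w: "A u2 w = 0" for z w
  proof -
    define z' where "z' = z + A z v1 \<odot> u1 + A z v2 \<odot> u2"
    define w' where "w' = w + A u1 w \<odot> v1 + A u2 w \<odot> v2"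
    have z': "left_null z'" and w': "right_null w'"
      unfolding z'_def w'_def by (rule left_null_residual right_null_residual)+
    have "C z' w' = C z' w + A u1 w * C z' v1"
      unfolding w'_def by (simp add: evaluate[OF C] w)
    then have "C z' w = 0" using null_null[OF C z' w'] twist(1)[OF C z'] tw[OF C] by simp
    moreover have "C u2 w' = C u2 w" unfolding w'_def by (simp add: evaluate[OF C] w corner[OF C])
    then have "C u2 w = 0" using twist(2)[OF C w'] tw[OF C] by simp
    ultimately show ?thesis unfolding z'_def evaluate[OF C] by (simp only: bit_prop; satx)
  qed
  show "minor2 C y y' x x' = 0"
    using *[OF x(1), of y] *[OF x(2), of y] *[OF x(1), of y'] *[OF x(2), of y']
    unfolding minor2_def by (simp only: bit_prop; satx)
qed (rule A)

text \<open>Suppose that \<open>D\<close> has a non-zero corner.  By \<open>M adj(K) L = 0\<close> for \<open>E\<close> and \<open>B + E\<close>, every such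
element \<open>E\<close> has exactly one non-zero border, which is a border of \<open>B\<close>.  Comparing \<open>D\<close> with \<open>D + C\<close>
for a \<open>C\<close> with zero corner, the borders of \<open>C\<close> are those of \<open>0\<close> or those of \<open>B\<close>, so that the
space would be spanned by \<open>A\<close>, \<open>B\<close> and \<open>D\<close>, contradicting its size.\<close>

lemma corner_zero:
  assumes tw: "\<And>C. C \<in> V \<Longrightarrow> C u2 x0 = 0" and D: "D \<in> V"
  shows "D u2 v1 = 0"
proof (rule ccontr)
  assume "D u2 v1 \<noteq> 0"
  then have Dc: "D u2 v1 = 1" by simp
  have shape: "E y0 v2 + E u1 x0 = 1 \<and> (\<forall>y. left_null y \<longrightarrow> E y v2 = E y0 v2 * B y v2) \<and>
      (\<forall>x. right_null x \<longrightarrow> E u1 x = E u1 x0 * B u1 x)"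
    if E: "E \<in> V" and Ec: "E u2 v1 = 1" for E
  proof -
    have *: "E y v2 * E u1 x = 0 \<and> (B y v2 + E y v2) * (B u1 x + E u1 x) = 0"
      if y: "left_null y" and x: "right_null x" for y x
      using border_adjugate[OF E y x] border_adjugate[OF add_closed[OF B E] y x]
        twist[OF E] tw[OF E] B_col[OF y] B_row[OF x] y x Ec B_corner by simp
    have e: "E y0 v2 + E u1 x0 = 1"
      using *[OF y0 x0] Bx0 By0 by (simp only: bit_prop; satx)
    moreover have "E y v2 = E y0 v2 * B y v2" if "left_null y" for y
      using *[OF that x0] e Bx0 by (simp only: bit_prop; satx)
    moreover have "E u1 x = E u1 x0 * B u1 x" if "right_null x" for x
      using *[OF y0 that] e By0 by (simp only: bit_prop; satx)
    ultimately show ?thesis by blast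
  qed
  obtain C where C: "C \<in> V" "C \<notin> {0, A, B, A + B, D, A + D, B + D, A + B + D}"
    using large[OF A B D] by blast
  \<comment> \<open>The sum of two elements with non-zero corner has zero corner.\<close>
  define C' where "C' = (if C u2 v1 = 0 then C else C + D)"
  have C': "C' \<in> V" "C' \<notin> {0, A, B, A + B}" "C' u2 v1 = 0"
    using C D add_closed Dc by (auto simp: C'_def form_add_move add.assoc)
  \<comment> \<open>Removing the remaining border of \<open>B\<close> leaves an unbordered element.\<close>
  define C'' where "C'' = (if C' y0 v2 = 0 then C' else C' + B)"
  have C'': "C'' \<in> V" "C'' \<noteq> 0" "C'' \<noteq> A"
    using C' B add_closed by (auto simp: C''_def form_add_move)
  have DC: "D + C' \<in> V" "(D + C') u2 v1 = 1" using add_closed[OF D C'(1)] Dc C'(3) by simp_all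
  note t = shape[OF D Dc] shape[OF DC, unfolded plus_fun_apply]
  have row: "C' y v2 = C' y0 v2 * B y v2" if "left_null y" for y
  proof -
    have "D y v2 = D y0 v2 * B y v2" "D y v2 + C' y v2 = (D y0 v2 + C' y0 v2) * B y v2"
      using t that by blast+
    then show ?thesis by (simp only: bit_prop; satx)
  qed
  have col: "C' u1 x = C' y0 v2 * B u1 x" if "right_null x" for x
  proof -
    have "D u1 x = D u1 x0 * B u1 x" "D u1 x + C' u1 x = (D u1 x0 + C' u1 x0) * B u1 x"
      "D y0 v2 + D u1 x0 = 1" "D y0 v2 + C' y0 v2 + (D u1 x0 + C' u1 x0) = 1"
      using t that by blast+
    then show ?thesis by (simp only: bit_prop; satx)
  qed
  have "unbordered C''"
    unfolding unbordered_def
    using twist[OF C''(1)] tw[OF C''(1)] row col by (auto simp: C''_def bit_add_self)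
  then show False using unbordered_cases[OF C''(1)] C'' by blast
qed

text \<open>An element with a non-zero twist can be corrected by \<open>B\<close> to the mirror image \<open>E\<close> of \<open>B\<close>, with the
borders of \<open>B\<close> in the other row and column.  The orthogonality of borders with \<open>B\<close> and \<open>E\<close>
then forces any element into the span of \<open>A\<close>, \<open>B\<close>, \<open>E\<close>.  This is where the alternating matrices of
size \<open>3\<close>, a space of dimension \<open>3\<close>, are excluded.\<close>

lemma twist_zero:
  assumes D: "D \<in> V"
  shows "D u2 x0 = 0"
proof (rule ccontr)
  assume "D u2 x0 \<noteq> 0"
  then have Dt: "D u2 x0 = 1" by simp
  have scaled: "E y v2 = E y0 v2 * B y v2 \<and> E u1 x = E y0 v2 * B u1 x"
    if E: "\<And>y x. left_null y \<Longrightarrow> right_null x \<Longrightarrow> E y v2 * B u1 x + B y v2 * E u1 x = 0"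
      and y: "left_null y" and x: "right_null x" for E y x
    using E[OF y x0] E[OF y0 x] E[OF y0 x0] Bx0 By0 by (simp only: bit_prop; satx)
  have Drow: "D y v1 = B y v2" if "left_null y" for y using twist(1)[OF D that] Dt by simp
  have Dcol: "D u2 x = B u1 x" if "right_null x" for x using twist(2)[OF D that] Dt by simp
  have "D y v2 * B u1 x + B y v2 * D u1 x = 0" if "left_null y" "right_null x" for y x
    using border_orthogonal[OF D that] Drow[OF that(1)] Dcol[OF that(2)]
    by (simp only: bit_prop; satx)
  then have D2: "D y v2 = D y0 v2 * B y v2 \<and> D u1 x = D y0 v2 * B u1 x"
    if "left_null y" "right_null x" for y x using scaled[of D] that by blast
  define E where "E = (if D y0 v2 = 0 then D else D + B)"
  have E: "E \<in> V" using D B add_closed by (simp add: E_def)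
  have Ey: "E y v1 = B y v2" "E y v2 = 0" if "left_null y" for y
    using D2[OF that x0] Drow[OF that] B_col[OF that] by (auto simp: E_def bit_add_self)
  have Ex: "E u2 x = B u1 x" "E u1 x = 0" if "right_null x" for x
    using D2[OF y0 that] Dcol[OF that] B_row[OF that] by (auto simp: E_def bit_add_self)
  obtain C where C: "C \<in> V" "C \<notin> {0, A, B, A + B, E, A + E, B + E, A + B + E}"
    using large[OF A B E] by blast
  define C' where "C' = (if C u2 x0 = 0 then C else C + E)"
  have C': "C' \<in> V" "C' \<notin> {0, A, B, A + B}" "C' u2 x0 = 0"
    using C E add_closed Ex(1)[OF x0] Bx0 by (auto simp: C'_def form_add_move add.assoc)
  define C'' where "C'' = (if C' y0 v2 = 0 then C' else C' + B)"
  have C'': "C'' \<in> V" "C'' \<noteq> 0" "C'' \<noteq> A"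
    using C' B add_closed by (auto simp: C''_def form_add_move)
  have "C' y v2 * B u1 x + B y v2 * C' u1 x = 0" if "left_null y" "right_null x" for y x
    using border_polar[OF E C'(1) that] Ey[OF that(1)] Ex[OF that(2)] twist(1)[OF C'(1) that(1)]
      twist(2)[OF C'(1) that(2)] C'(3)
    by (simp only: bit_prop; satx)
  then have "C' y v2 = C' y0 v2 * B y v2 \<and> C' u1 x = C' y0 v2 * B u1 x"
    if "left_null y" "right_null x" for y x using scaled[of C'] that by blast
  then have border: "left_null y \<Longrightarrow> C' y v2 = C' y0 v2 * B y v2"
    "right_null x \<Longrightarrow> C' u1 x = C' y0 v2 * B u1 x" for y x using y0 x0 by blast+
  have "left_null y \<Longrightarrow> C' y v1 = 0" "right_null x \<Longrightarrow> C' u2 x = 0" for y x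
    using twist[OF C'(1)] C'(3) by simp_all
  then have "unbordered C''"
    unfolding unbordered_def C''_def using border B_col B_row
    by (cases "C' y0 v2 = 0") (simp_all add: bit_add_self)
  then show False using unbordered_cases[OF C''(1)] C'' by blast
qed

lemma collapses: "collapses V"
  using collapses_if_corner_zero corner_zero twist_zero by blast

end

context framed
begin

text \<open>A change of frame brings the pair of orthogonal non-zero vectors \<open>L\<close> and \<open>M\<close> into the standard
position; there are three such pairs over two elements.\<close>

lemma collapses_of_borders:
  assumes B: "B \<in> V" and y: "left_null y" and x: "right_null x"
    and M: "B y v1 = 1 \<or> B y v2 = 1" and L: "B u1 x = 1 \<or> B u2 x = 1"
  shows "collapses V"
proof -
  have concl: "collapses V" if "frame A s1 s2 t1 t2"
    "B s1 x = 1" "B s2 x = 0" "B y t1 = 0" "B y t2 = 1" for s1 s2 t1 t2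
  proof -
    interpret f: framed V A s1 s2 t1 t2 by unfold_locales (rule A that(1))+
    interpret framed_pair V A s1 s2 t1 t2 B y x
      by unfold_locales (use that B y x in \<open>simp_all add: left_null_def right_null_def
        f.left_null_def f.right_null_def\<close>)
    show ?thesis by (rule collapses)
  qed
  note orth = border_orthogonal[OF B y x]
  consider "B u1 x = 1" "B u2 x = 0" "B y v1 = 0" "B y v2 = 1"
    | "B u2 x = 1" "B u1 x = 0" "B y v2 = 0" "B y v1 = 1"
    | "B u1 x = 1" "B u2 x = 1" "B y v1 = 1" "B y v2 = 1"
    using orth M L by (simp only: bit_prop; satx)
  then show ?thesis
  proof cases
    case 1
    then show ?thesis using concl[OF frame] by blast
  next
    case 2
    have "frame A u2 u1 v2 v1" using frame unfolding frame_def by simp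
    then show ?thesis using concl 2 by blast
  next
    case 3
    have "frame A u1 (u1 + u2) (v1 + v2) v2" using frame unfolding frame_def by (simp add: evaluate[OF A])
    then show ?thesis using concl[of u1 "u1 + u2" "v1 + v2" v2] 3 by (simp add: evaluate[OF B])
  qed
qed

end

context pencil_free
begin

text \<open>Either all right borders vanish, or all lower borders vanish, or, adding two elements if necessary,
some element has both.\<close>

theorem collapses_or_dual: "collapses V \<or> collapses ((\<lambda>C x y. C y x) ` V)"
proof -
  obtain A where A: "A \<in> V" "A \<noteq> 0" using large[OF zero_mem zero_mem zero_mem] by auto
  obtain u1 u2 v1 v2 where fr: "frame A u1 u2 v1 v2" using frame_exists[OF A] by blast
  interpret framed V A u1 u2 v1 v2 by unfold_locales (rule A(1) fr)+
  interpret dual: pencil_free "(\<lambda>C x y. C y x) ` V" by (rule pencil_free_dual)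
  interpret dual: framed "(\<lambda>C x y. C y x) ` V" "\<lambda>x y. A y x" v1 v2 u1 u2
    by unfold_locales (use A(1) fr in \<open>auto simp: frame_def\<close>)
  show ?thesis
  proof (rule ccontr)
    assume no: "\<not> ?thesis"
    obtain C x where C: "C \<in> V" "right_null x" "C u1 x = 1 \<or> C u2 x = 1"
      using collapses_if_rows_zero no by (metis bit_not_zero_iff)
    have "\<not> (\<forall>D\<in>V. \<forall>y. left_null y \<longrightarrow> D y v1 = 0 \<and> D y v2 = 0)"
    proof
      assume "\<forall>D\<in>V. \<forall>y. left_null y \<longrightarrow> D y v1 = 0 \<and> D y v2 = 0"
      then have "collapses ((\<lambda>C x y. C y x) ` V)"
        by (intro dual.collapses_if_rows_zero) (auto simp: dual.right_null_def left_null_def)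
      then show False using no by blast
    qed
    then obtain D y where D: "D \<in> V" "left_null y" "D y v1 = 1 \<or> D y v2 = 1"
      by (metis bit_not_zero_iff)
    have CD: "C + D \<in> V" using C D add_closed by blast
    show False
    proof (cases "C y v1 = 1 \<or> C y v2 = 1")
      case True
      then show False using collapses_of_borders[OF C(1) D(2) C(2)] C(3) no by blast
    next
      case Cy: False
      show False
      proof (cases "D u1 x = 1 \<or> D u2 x = 1")
        case True
        then show False using collapses_of_borders[OF D(1) D(2) C(2)] D(3) no by blast
      next
        case False
        then show False using collapses_of_borders[OF CD D(2) C(2)] Cy C(3) D(3) no by auto
      qed
    qed
  qed
qed

end

section \<open>Spaces with the exceptional pencil\<close>

text \<open>The forms are, on the three vectors on either side, precisely the matrices of \<^const>\<open>V3_F2\<close>, and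
modulo the common kernels the three vectors span.\<close>

definition V3_frame ::
    "('a \<Rightarrow> 'b \<Rightarrow> bit) set \<Rightarrow> 'a \<Rightarrow> 'a \<Rightarrow> 'a \<Rightarrow> 'b \<Rightarrow> 'b \<Rightarrow> 'b \<Rightarrow> bool" where
  "V3_frame V y1 y2 y3 x1 x2 x3 \<longleftrightarrow>
     (\<forall>C\<in>V. C y1 x1 = 0 \<and> C y2 x2 = 0 \<and> C y3 x3 = 0 \<and>
        C y3 x1 = C y1 x2 + C y2 x3 \<and> C y1 x3 = C y2 x1 + C y3 x2) \<and>
     (\<forall>a b c d. \<exists>C\<in>V. C y1 x2 = a \<and> C y2 x3 = b \<and> C y2 x1 = c \<and> C y3 x2 = d) \<and>
     (\<forall>y. \<exists>a b c. \<forall>C\<in>V. \<forall>x. C y x = a * C y1 x + b * C y2 x + c * C y3 x) \<and>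
     (\<forall>x. \<exists>a b c. \<forall>C\<in>V. \<forall>y. C y x = a * C y x1 + b * C y x2 + c * C y x3)"

text \<open>The six arguments are the entries off the diagonal of a matrix of size \<open>3\<close> with zero diagonal,
read as a directed graph on three vertices with an edge from \<open>i\<close> to \<open>j\<close> if \<open>c\<^sub>i\<^sub>j = 1\<close>.  The first
three conditions say that all sums of the matrix with a member of the diagonal pencil are singular,
the others that the graph is not concentrated in one row or one column.  The graphs satisfying them
are the complete graph, the six directed paths with two edges and the six transitive tournaments.\<close>

definition admissible :: "bit \<Rightarrow> bit \<Rightarrow> bit \<Rightarrow> bit \<Rightarrow> bit \<Rightarrow> bit \<Rightarrow> bool" where
  "admissible c12 c13 c21 c23 c31 c32 \<longleftrightarrow>
     c12 * c21 = c13 * c31 \<and> c12 * c21 = c23 * c32 \<and> c12 * c23 * c31 = c13 * c32 * c21 \<and>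
     (c21 = 1 \<or> c23 = 1 \<or> c31 = 1 \<or> c32 = 1) \<and>
     (c12 = 1 \<or> c13 = 1 \<or> c31 = 1 \<or> c32 = 1) \<and>
     (c12 = 1 \<or> c13 = 1 \<or> c21 = 1 \<or> c23 = 1) \<and>
     (c12 = 1 \<or> c13 = 1 \<or> c23 = 1 \<or> c32 = 1) \<and>
     (c13 = 1 \<or> c23 = 1 \<or> c21 = 1 \<or> c31 = 1) \<and>
     (c12 = 1 \<or> c32 = 1 \<or> c21 = 1 \<or> c31 = 1)"

text \<open>The graphs whose symmetric difference with the path \<open>1 \<rightarrow> 2 \<rightarrow> 3\<close> is again admissible are the
two other paths of the cycle \<open>1 \<rightarrow> 2 \<rightarrow> 3 \<rightarrow> 1\<close>.\<close>

lemma admissible_path: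
  assumes "admissible c12 c13 c21 c23 c31 c32"
    and "admissible (c12 + 1) c13 c21 (c23 + 1) c31 c32"
  shows "c13 = 0 \<and> c21 = 0 \<and> c32 = 0 \<and> c12 = c23 + c31"
  using assms unfolding admissible_def by (simp only: bit_prop; satx)

text \<open>For the transitive tournament on \<open>1, 2, 3\<close> they are the complete graph and the opposite tournament.\<close>

lemma admissible_transitive:
  assumes "admissible c12 c13 c21 c23 c31 c32"
    and "admissible (c12 + 1) (c13 + 1) c21 (c23 + 1) c31 c32"
  shows "c13 = c12 \<and> c23 = c12 \<and> c31 = c21 \<and> c32 = c21"
  using assms unfolding admissible_def by (simp only: bit_prop; satx)

text \<open>Apart from the complete graph, each admissible graph contains a path \<open>i \<rightarrow> j \<rightarrow> k\<close> without any
of the reversed edges \<open>j \<rightarrow> i\<close>, \<open>k \<rightarrow> j\<close>, \<open>k \<rightarrow> i\<close>.\<close>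

lemma admissible_cases:
  assumes "admissible c12 c13 c21 c23 c31 c32"
  shows "c12 = 1 \<and> c13 = 1 \<and> c21 = 1 \<and> c23 = 1 \<and> c31 = 1 \<and> c32 = 1 \<or>
    c12 = 1 \<and> c23 = 1 \<and> c21 = 0 \<and> c32 = 0 \<and> c31 = 0 \<or>
    c13 = 1 \<and> c32 = 1 \<and> c31 = 0 \<and> c23 = 0 \<and> c21 = 0 \<or>
    c21 = 1 \<and> c13 = 1 \<and> c12 = 0 \<and> c31 = 0 \<and> c32 = 0 \<or>
    c23 = 1 \<and> c31 = 1 \<and> c32 = 0 \<and> c13 = 0 \<and> c12 = 0 \<or>
    c31 = 1 \<and> c12 = 1 \<and> c13 = 0 \<and> c21 = 0 \<and> c23 = 0 \<or>
    c32 = 1 \<and> c21 = 1 \<and> c23 = 0 \<and> c12 = 0 \<and> c13 = 0"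
  using assms unfolding admissible_def by (simp only: bit_prop; satx)

locale diag_framed = rank2_forms +
  fixes A B y1 y2 y3 x1 x2 x3
  assumes A: "A \<in> V" and B: "B \<in> V" and d: "diag_frame A B y1 y2 y3 x1 x2 x3"
begin

lemma expand_right:
  assumes C: "C \<in> V"
  shows "C y x = A y1 x * C y x1 + B y2 x * C y x2 + A y3 x * C y x3"
proof -
  interpret dual: rank2_forms "(\<lambda>C x y. C y x) ` V" by (rule dual)
  have d': "diag_frame (\<lambda>x y. A y x) (\<lambda>x y. B y x) x1 x2 x3 y1 y2 y3"
    using d unfolding diag_frame_def by simp
  show ?thesis using dual.expand_left[OF _ _ _ d', of "\<lambda>x y. C y x" x y] A B C by blast
qed

lemmas row_expand = expand_left[OF A B _ d]

text \<open>A form is determined by its nine values on the frame; if these are products, its rank is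
less than \<open>2\<close> and it vanishes.\<close>

lemma rank_one_grid:
  assumes C: "C \<in> V"
    and "C y1 x1 = r1 * s1" "C y1 x2 = r1 * s2" "C y1 x3 = r1 * s3"
    "C y2 x1 = r2 * s1" "C y2 x2 = r2 * s2" "C y2 x3 = r2 * s3"
    "C y3 x1 = r3 * s1" "C y3 x2 = r3 * s2" "C y3 x3 = r3 * s3"
  shows "C = 0"
proof (rule ccontr)
  assume "C \<noteq> 0"
  then obtain a b c e where m: "minor2 C a b c e = 1" using minor2_one[OF C] by blast
  have "C y x = (A y x1 * r1 + B y x2 * r2 + A y x3 * r3) *
      (A y1 x * s1 + B y2 x * s2 + A y3 x * s3)" for y x
    unfolding row_expand[OF C, of y x] expand_right[OF C, of y1 x] expand_right[OF C, of y2 x]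
      expand_right[OF C, of y3 x] assms(2-) by (simp only: algebra_simps)
  then have "minor2 C a b c e = 0" 
    by (rule minor2_product[where f = "\<lambda>y. A y x1 * r1 + B y x2 * r2 + A y x3 * r3"
        and g = "\<lambda>x. A y1 x * s1 + B y2 x * s2 + A y3 x * s3"])
  then show False using m by simp
qed

text \<open>Representatives modulo the pencil of \<open>A\<close> and \<open>B\<close>; as the trace vanishes, their whole diagonal is
zero.\<close>

definition centred where
  "centred C \<longleftrightarrow> C \<in> V \<and> C y1 x1 = 0 \<and> C y2 x2 = 0"

definition centre where
  "centre C = C + C y1 x1 \<odot> A + C y2 x2 \<odot> B"

lemma scale_form: "(a \<odot> C) y x = a * C y x"
  by (cases a) (simp_all add: scale_def)

lemma scale_mem: "C \<in> V \<Longrightarrow> a \<odot> C \<in> V"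
  by (simp add: scale_def zero_mem)

lemma centred_centre: "C \<in> V \<Longrightarrow> centred (centre C)"
  using d unfolding centred_def centre_def diag_frame_def
  by (auto intro!: add_closed scale_mem A B simp: scale_form bit_add_self)

lemma centre_notin:
  assumes "C \<notin> {D, A + D, B + D, A + B + D}"
  shows "centre C \<noteq> D"
proof
  assume "centre C = D"
  then have "C = D + C y2 x2 \<odot> B + C y1 x1 \<odot> A" unfolding centre_def by (simp add: form_add_move)
  then have "C \<in> {D, A + D, B + D, A + B + D}"
    by (cases "C y1 x1"; cases "C y2 x2") (simp_all add: scale_def ac_simps)
  then show False using assms by blast
qed

lemma centred_add: "centred C \<Longrightarrow> centred D \<Longrightarrow> centred (C + D)"
  by (simp add: centred_def add_closed)

lemma centred_trace: "centred C \<Longrightarrow> C y3 x3 = 0"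
  using trace_zero[OF A B _ d, of C] by (simp add: centred_def)

lemma centred_admissible:
  assumes c: "centred C" and C0: "C \<noteq> 0"
  shows "admissible (C y1 x2) (C y1 x3) (C y2 x1) (C y2 x3) (C y3 x1) (C y3 x2)"
proof -
  have C: "C \<in> V" and diag: "C y1 x1 = 0" "C y2 x2 = 0" "C y3 x3 = 0"
    using c centred_trace[OF c] by (simp_all add: centred_def)
  have rel: "C y1 x2 * C y2 x1 = C y1 x3 * C y3 x1" "C y1 x2 * C y2 x1 = C y2 x3 * C y3 x2"
    "C y1 x2 * C y2 x3 * C y3 x1 = C y1 x3 * C y3 x2 * C y2 x1"
    using diag_frame_minor[OF A B C, of y1 y2 y3 x1 x2 x3] d diag
    unfolding minor3_def diag_frame_def plus_fun_apply
    by ((simp only: bit_prop; satx)+)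
  have "C y2 x1 = 1 \<or> C y2 x3 = 1 \<or> C y3 x1 = 1 \<or> C y3 x2 = 1"
    using rank_one_grid[OF C, of 1 0 "C y1 x2" "C y1 x3" 0 0, unfolded mult_1_left mult_1_right mult_zero_left mult_zero_right] C0 diag
    by (metis bit_not_one_iff)
  moreover have "C y1 x2 = 1 \<or> C y1 x3 = 1 \<or> C y3 x1 = 1 \<or> C y3 x2 = 1"
    using rank_one_grid[OF C, of 0 "C y2 x1" 0 "C y2 x3" 1 0, unfolded mult_1_left mult_1_right mult_zero_left mult_zero_right] C0 diag
    by (metis bit_not_one_iff)
  moreover have "C y1 x2 = 1 \<or> C y1 x3 = 1 \<or> C y2 x1 = 1 \<or> C y2 x3 = 1"
    using rank_one_grid[OF C, of 0 "C y3 x1" "C y3 x2" 0 0 1, unfolded mult_1_left mult_1_right mult_zero_left mult_zero_right] C0 diag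
    by (metis bit_not_one_iff)
  moreover have "C y1 x2 = 1 \<or> C y1 x3 = 1 \<or> C y2 x3 = 1 \<or> C y3 x2 = 1"
    using rank_one_grid[OF C, of 0 1 0 0 "C y2 x1" "C y3 x1", unfolded mult_1_left mult_1_right mult_zero_left mult_zero_right] C0 diag
    by (metis bit_not_one_iff)
  moreover have "C y1 x3 = 1 \<or> C y2 x3 = 1 \<or> C y2 x1 = 1 \<or> C y3 x1 = 1"
    using rank_one_grid[OF C, of "C y1 x2" 0 1 0 0 "C y3 x2", unfolded mult_1_left mult_1_right mult_zero_left mult_zero_right] C0 diag
    by (metis bit_not_one_iff)
  moreover have "C y1 x2 = 1 \<or> C y3 x2 = 1 \<or> C y2 x1 = 1 \<or> C y3 x1 = 1"
    using rank_one_grid[OF C, of "C y1 x3" 0 0 1 "C y2 x3" 0, unfolded mult_1_left mult_1_right mult_zero_left mult_zero_right] C0 diag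
    by (metis bit_not_one_iff)
  ultimately show ?thesis unfolding admissible_def using rel by blast
qed

text \<open>The space contains two centred elements that are independent, and two functionals which are jointly
injective on centred elements separate them.  Cramer's rule then yields every value of the four
coordinates.\<close>

lemma parametrization:
  assumes inj: "\<And>C. centred C \<Longrightarrow> C p q = 0 \<Longrightarrow> C r s = 0 \<Longrightarrow> C = 0"
    and AB: "A p q = 0" "A r s = 0" "B p q = 0" "B r s = 0"
  shows "\<exists>C\<in>V. C y1 x1 = a \<and> C y2 x2 = b \<and> C p q = c \<and> C r s = e"
proof -
  \<comment> \<open>Repeating \<open>A\<close> asks for an element outside the span of \<open>A\<close> and \<open>B\<close>.\<close>
  obtain C' where C': "C' \<in> V" "C' \<notin> {0, A, B, A + B}" using large[OF A B A] by auto
  define C where "C = centre C'"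
  have C: "centred C" "C \<noteq> 0"
    using centred_centre C'(1) centre_notin[of C' 0] C'(2) by (auto simp: C_def)
  have CV: "C \<in> V" using C(1) by (simp add: centred_def)
  obtain D' where D': "D' \<in> V" "D' \<notin> {0, A, B, A + B, C, A + C, B + C, A + B + C}"
    using large[OF A B CV] by blast
  define D where "D = centre D'"
  have D: "centred D" "D \<noteq> 0" "D \<noteq> C"
    using centred_centre D'(1) centre_notin[of D' 0] centre_notin[of D' C] D'(2) by (auto simp: D_def)
  have DV: "D \<in> V" using D(1) by (simp add: centred_def)
  have "C + D \<noteq> 0" using D(3) by (auto simp: form_add_move)
  then have "\<not> (C p q = 0 \<and> C r s = 0)" "\<not> (D p q = 0 \<and> D r s = 0)"
    "\<not> (C p q + D p q = 0 \<and> C r s + D r s = 0)"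
    using inj[OF C(1)] inj[OF D(1)] inj[OF centred_add[OF C(1) D(1)]] C(2) D(2) by auto
  then have det: "C p q * D r s + C r s * D p q = 1" by (simp only: bit_prop; satx)
  define E where "E = a \<odot> A + b \<odot> B + (c * D r s + e * D p q) \<odot> C + (c * C r s + e * C p q) \<odot> D"
  have "E \<in> V" unfolding E_def by (intro add_closed scale_mem A B CV DV)
  moreover have "E y1 x1 = a" "E y2 x2 = b"
    using C(1) D(1) d unfolding E_def centred_def diag_frame_def plus_fun_apply scale_form
    by simp_all
  moreover have "E p q = c" "E r s = e"
    using det AB unfolding E_def plus_fun_apply scale_form by ((simp only: bit_prop; satx)+)
  ultimately show ?thesis by blast
qed

lemma span_rows: "\<exists>a b c. \<forall>C\<in>V. \<forall>x. C y x = a * C y1 x + b * C y2 x + c * C y3 x"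
  using row_expand by blast

lemma span_cols: "\<exists>a b c. \<forall>C\<in>V. \<forall>y. C y x = a * C y x1 + b * C y x2 + c * C y x3"
  using expand_right by blast

text \<open>Moving the last column to the front carries the diagonal pencil and the edges \<open>2 \<rightarrow> 3\<close>,
\<open>3 \<rightarrow> 1\<close> to the positions of the four parameters of \<^const>\<open>V3_F2\<close>.\<close>

lemma V3_frame_of_path:
  assumes pat: "\<And>C. centred C \<Longrightarrow> C y1 x3 = 0 \<and> C y2 x1 = 0 \<and> C y3 x2 = 0 \<and> C y1 x2 = C y2 x3 + C y3 x1"
  shows "V3_frame V y1 y2 y3 x3 x1 x2"
proof -
  have grid: "C y1 x3 = 0" "C y2 x1 = 0" "C y3 x2 = 0" "C y1 x2 = C y2 x3 + C y3 x1"
    if C: "C \<in> V" for C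
    using pat[OF centred_centre[OF C]] d
    unfolding centre_def plus_fun_apply scale_form diag_frame_def
    by ((simp only: bit_prop; satx)+)
  have inj: "C = 0" if c: "centred C" and "C y2 x3 = 0" "C y3 x1 = 0" for C
    using rank_one_grid[of C 0 0 0 0 0 0] pat[OF c] that centred_trace[OF c]
    unfolding centred_def by simp
  have "\<exists>C\<in>V. C y1 x1 = a \<and> C y2 x2 = b \<and> C y2 x3 = c \<and> C y3 x1 = e" for a b c e
    by (rule parametrization[OF inj]) (use d in \<open>auto simp: diag_frame_def\<close>)
  moreover have "\<exists>a b c. \<forall>C\<in>V. \<forall>y. C y x = a * C y x3 + b * C y x1 + c * C y x2" for x
  proof -
    obtain a b c where *: "\<forall>C\<in>V. \<forall>y. C y x = a * C y x1 + b * C y x2 + c * C y x3"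
      using span_cols by blast
    have "\<forall>C\<in>V. \<forall>y. C y x = c * C y x3 + a * C y x1 + b * C y x2"
      using * by (simp only: ac_simps)
    then show ?thesis by blast
  qed
  ultimately show ?thesis
    unfolding V3_frame_def using grid trace_zero[OF A B _ d] span_rows by simp
qed

text \<open>The tournament and its opposite span a space that is equivalent to the previous one: in the new
basis it is \<^const>\<open>V3_F2\<close> again.\<close>

lemma V3_frame_of_transitive:
  assumes pat: "\<And>C. centred C \<Longrightarrow> C y1 x3 = C y1 x2 \<and> C y2 x3 = C y1 x2 \<and>
    C y3 x1 = C y2 x1 \<and> C y3 x2 = C y2 x1"
  shows "V3_frame V y3 (y2 + y3) y1 (x1 + x2) x1 (x2 + x3)"
proof -
  have grid: "C y1 x3 = C y1 x2" "C y2 x3 = C y1 x2" "C y3 x1 = C y2 x1" "C y3 x2 = C y2 x1"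
    if C: "C \<in> V" for C
    using pat[OF centred_centre[OF C]] d
    unfolding centre_def plus_fun_apply scale_form diag_frame_def
    by ((simp only: bit_prop; satx)+)
  have inj: "C = 0" if c: "centred C" and "C y1 x2 = 0" "C y2 x1 = 0" for C
    using rank_one_grid[of C 0 0 0 0 0 0] pat[OF c] that centred_trace[OF c]
    unfolding centred_def by simp
  have *: "\<exists>C\<in>V. C y1 x1 = a \<and> C y2 x2 = b \<and> C y1 x2 = c \<and> C y2 x1 = e" for a b c e
    by (rule parametrization[OF inj]) (use d in \<open>auto simp: diag_frame_def\<close>)
  show ?thesis
    unfolding V3_frame_def
  proof (intro conjI ballI allI)
    fix C assume C: "C \<in> V"
    note g = grid[OF C] trace_zero[OF A B C d]
    show "C y3 (x1 + x2) = 0" "C (y2 + y3) x1 = 0" "C y1 (x2 + x3) = 0"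
      "C y1 (x1 + x2) = C y3 x1 + C (y2 + y3) (x2 + x3)"
      "C y3 (x2 + x3) = C (y2 + y3) (x1 + x2) + C y1 x1"
      unfolding evaluate[OF C] g by ((simp only: bit_prop; satx)+)
  next
    fix a b c e
    obtain C where C: "C \<in> V" "C y1 x1 = e \<and> C y2 x2 = a + c \<and> C y1 x2 = a + b + e \<and> C y2 x1 = a"
      using * by blast
    note g = grid[OF C(1)] trace_zero[OF A B C(1) d]
    have "C y3 x1 = a" "C (y2 + y3) (x2 + x3) = b" "C (y2 + y3) (x1 + x2) = c" "C y1 x1 = e"
      unfolding evaluate[OF C(1)] g using C(2) by ((simp only: bit_prop; satx)+)
    then show "\<exists>C\<in>V. C y3 x1 = a \<and> C (y2 + y3) (x2 + x3) = b \<and> C (y2 + y3) (x1 + x2) = c \<and> C y1 x1 = e"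
      using C(1) by blast
  next
    fix y
    obtain a b c where "\<And>C x. C \<in> V \<Longrightarrow> C y x = a * C y1 x + b * C y2 x + c * C y3 x"
      using span_rows by blast
    note * = this
    have "C y x = (b + c) * C y3 x + b * C (y2 + y3) x + a * C y1 x" if C: "C \<in> V" for C x
      using *[OF C] unfolding evaluate[OF C] by (simp only: bit_prop; satx)
    then show "\<exists>a b c. \<forall>C\<in>V. \<forall>x. C y x = a * C y3 x + b * C (y2 + y3) x + c * C y1 x" by blast
  next
    fix x
    obtain a b c where "\<And>C y. C \<in> V \<Longrightarrow> C y x = a * C y x1 + b * C y x2 + c * C y x3"
      using span_cols by blast
    note * = this
    have "C y x = (b + c) * C y (x1 + x2) + (a + b + c) * C y x1 + c * C y (x2 + x3)"
      if C: "C \<in> V" for C y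
      using *[OF C] unfolding evaluate[OF C] by (simp only: bit_prop; satx)
    then show "\<exists>a b c. \<forall>C\<in>V. \<forall>y. C y x = a * C y (x1 + x2) + b * C y x1 + c * C y (x2 + x3)" by blast
  qed
qed

lemma V3_frame_of_chain:
  assumes C: "centred C" and 1: "C y1 x2 = 1" "C y2 x3 = 1"
    and 0: "C y2 x1 = 0" "C y3 x2 = 0" "C y3 x1 = 0"
  shows "\<exists>y1 y2 y3 x1 x2 x3. V3_frame V y1 y2 y3 x1 x2 x3"
proof (cases "C y1 x3 = 0")
  case C13: True
  have "D y1 x3 = 0 \<and> D y2 x1 = 0 \<and> D y3 x2 = 0 \<and> D y1 x2 = D y2 x3 + D y3 x1"
    if D: "centred D" for D
  proof (cases "D = 0 \<or> D = C")
    case True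
    then show ?thesis using 0 1 \<open>C y1 x3 = 0\<close> by auto
  next
    case False
    then have nz: "D \<noteq> 0" "D + C \<noteq> 0" by (auto simp: form_add_move)
    show ?thesis
      using admissible_path[OF centred_admissible[OF D nz(1)]
          centred_admissible[OF centred_add[OF D C] nz(2), unfolded plus_fun_apply 0 1 C13 add_0_right]]
      by blast
  qed
  then show ?thesis using V3_frame_of_path by blast
next
  case False
  then have 13: "C y1 x3 = 1" by simp
  have "D y1 x3 = D y1 x2 \<and> D y2 x3 = D y1 x2 \<and> D y3 x1 = D y2 x1 \<and> D y3 x2 = D y2 x1"
    if D: "centred D" for D
  proof (cases "D = 0 \<or> D = C")
    case True
    then show ?thesis using 0 1 13 by auto
  next
    case False
    then have nz: "D \<noteq> 0" "D + C \<noteq> 0" by (auto simp: form_add_move)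
    show ?thesis
      using admissible_transitive[OF centred_admissible[OF D nz(1)]
          centred_admissible[OF centred_add[OF D C] nz(2), unfolded plus_fun_apply 0 1 13 add_0_right]]
      by blast
  qed
  then show ?thesis using V3_frame_of_transitive by blast
qed

text \<open>The pencil \<open>diag (s, t, s + t)\<close> is mapped to itself by the simultaneous permutations of rows and
columns, which relabel the vertices of the graphs.\<close>

lemma swap12: "diag_framed V B A y2 y1 y3 x2 x1 x3"
  using d by unfold_locales (auto simp: A B diag_frame_def)

lemma swap23: "diag_framed V (A + B) B y1 y3 y2 x1 x3 x2"
  using d add_closed[OF A B] by unfold_locales (auto simp: A B diag_frame_def)

lemma centred_swap:
  "centred C \<Longrightarrow> diag_framed.centred V y2 y1 x2 x1 C"
  "centred C \<Longrightarrow> diag_framed.centred V y1 y3 x1 x3 C"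
  using diag_framed.centred_def[OF swap12] diag_framed.centred_def[OF swap23] centred_trace
  by (auto simp: centred_def)

text \<open>A space of centred elements containing only zero and the complete graph would be determined by one
coordinate, contradicting the size of the space.\<close>

lemma incomplete_exists:
  "\<exists>C. centred C \<and> C \<noteq> 0 \<and> \<not> (C y1 x2 = 1 \<and> C y1 x3 = 1 \<and> C y2 x1 = 1 \<and>
     C y2 x3 = 1 \<and> C y3 x1 = 1 \<and> C y3 x2 = 1)"
proof (rule ccontr)
  assume "\<not> ?thesis"
  then have complete: "C y1 x2 = 1 \<and> C y1 x3 = 1 \<and> C y2 x1 = 1 \<and> C y2 x3 = 1 \<and> C y3 x1 = 1 \<and> C y3 x2 = 1"
    if "centred C" "C \<noteq> 0" for C using that by blast
  have inj: "C = 0" if "centred C" "C y1 x2 = 0" "C y1 x3 = 0" for C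
  proof (rule ccontr)
    assume "C \<noteq> 0"
    then show False using complete[OF that(1)] that(2) by simp
  qed
  have "\<exists>C\<in>V. C y1 x1 = 0 \<and> C y2 x2 = 0 \<and> C y1 x2 = 1 \<and> C y1 x3 = 0"
    by (rule parametrization[OF inj]) (use d in \<open>auto simp: diag_frame_def\<close>)
  then obtain C where "centred C" "C y1 x2 = 1" "C y1 x3 = 0" by (auto simp: centred_def)
  moreover have "C \<noteq> 0" using calculation(2) by auto
  ultimately show False using complete[of C] by simp
qed

text \<open>The six relabelings bring the path in an incomplete admissible graph to \<open>1 \<rightarrow> 2 \<rightarrow> 3\<close>.\<close>

theorem V3_frame_exists: "\<exists>y1 y2 y3 x1 x2 x3. V3_frame V y1 y2 y3 x1 x2 x3"
proof -
  interpret p213: diag_framed V B A y2 y1 y3 x2 x1 x3 by (rule swap12)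
  interpret p132: diag_framed V "A + B" B y1 y3 y2 x1 x3 x2 by (rule swap23)
  interpret p231: diag_framed V "B + A" A y2 y3 y1 x2 x3 x1 by (rule p213.swap23)
  interpret p312: diag_framed V B "A + B" y3 y1 y2 x3 x1 x2 by (rule p132.swap12)
  interpret p321: diag_framed V A "B + A" y3 y2 y1 x3 x2 x1 by (rule p231.swap12)
  obtain C where C: "centred C" "C \<noteq> 0"
    "\<not> (C y1 x2 = 1 \<and> C y1 x3 = 1 \<and> C y2 x1 = 1 \<and> C y2 x3 = 1 \<and> C y3 x1 = 1 \<and> C y3 x2 = 1)"
    using incomplete_exists by blast
  note c = C(1) centred_swap[OF C(1)]
  note c' = c p213.centred_swap(2)[OF c(2)] p132.centred_swap(1)[OF c(3)]
  note c'' = c' p231.centred_swap(1)[OF c'(4)]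
  show ?thesis
    using admissible_cases[OF centred_admissible[OF C(1,2)]] C(3)
      V3_frame_of_chain[OF c''(1)] p213.V3_frame_of_chain[OF c''(2)] p132.V3_frame_of_chain[OF c''(3)]
      p231.V3_frame_of_chain[OF c''(4)] p312.V3_frame_of_chain[OF c''(5)]
      p321.V3_frame_of_chain[OF c''(6)]
    by blast
qed

end

context rank2_forms
begin

theorem trichotomy:
  "collapses V \<or> collapses ((\<lambda>C x y. C y x) ` V) \<or>
   (\<exists>y1 y2 y3 x1 x2 x3. V3_frame V y1 y2 y3 x1 x2 x3)"
proof (cases "pencil_free V")
  case True
  then show ?thesis using pencil_free.collapses_or_dual by blast
next
  case False
  then obtain A B y x where "A \<in> V" "B \<in> V" "A \<noteq> 0" "\<And>x'. A y x' = 0" "\<And>y'. A y' x = 0" "B y x \<noteq> 0"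
    unfolding pencil_free_def pencil_free_axioms_def using rank2_forms_axioms by blast
  moreover obtain y1 y2 y3 x1 x2 x3 where "diag_frame A B y1 y2 y3 x1 x2 x3"
    using diag_frame_of_kernels[of A B y x] calculation by auto
  ultimately interpret diag_framed V A B y1 y2 y3 x1 x2 x3 by unfold_locales
  show ?thesis using V3_frame_exists by blast
qed
end

text \<open>Sums and products of bits are kept as ring operations here, since otherwise the rules for finite sums
do not apply to them.\<close>

declare add_bit_eq_xor [simp del] mult_bit_eq_and [simp del]

section \<open>From matrices to forms\<close>

text \<open>The bilinear form of a matrix.  Vectors are functions on all natural numbers, of which only the
first \<open>n\<close> or \<open>p\<close> values matter; this gives total additive types on both sides.\<close>

definition form :: "nat \<Rightarrow> nat \<Rightarrow> bit mat \<Rightarrow> (nat \<Rightarrow> bit) \<Rightarrow> (nat \<Rightarrow> bit) \<Rightarrow> bit" where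
  "form n p M y x = (\<Sum>i<n. \<Sum>j<p. y i * M $$ (i, j) * x j)"

definition unit_fun :: "nat \<Rightarrow> nat \<Rightarrow> bit" where
  "unit_fun i = (\<lambda>k. if k = i then 1 else 0)"

lemma form_unit_left:
  assumes "i < n"
  shows "form n p M (unit_fun i) x = (\<Sum>j<p. M $$ (i, j) * x j)"
proof -
  have "form n p M (unit_fun i) x = (\<Sum>k<n. if k = i then \<Sum>j<p. M $$ (k, j) * x j else 0)"
    unfolding form_def unit_fun_def by (intro sum.cong) auto
  then show ?thesis using assms by simp
qed

lemma form_unit:
  assumes "i < n" "j < p"
  shows "form n p M (unit_fun i) (unit_fun j) = M $$ (i, j)"
proof -
  have "form n p M (unit_fun i) (unit_fun j) = (\<Sum>k<p. if k = j then M $$ (i, k) else 0)"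
    unfolding form_unit_left[OF assms(1)] by (intro sum.cong) (auto simp: unit_fun_def)
  then show ?thesis using assms by simp
qed

lemma form_add:
  "M \<in> carrier_mat n p \<Longrightarrow> N \<in> carrier_mat n p \<Longrightarrow> form n p (M + N) = form n p M + form n p N"
  unfolding form_def fun_eq_iff plus_fun_apply sum.distrib[symmetric]
  by (intro allI sum.cong) (auto simp: algebra_simps)

lemma form_zero: "form n p (0\<^sub>m n p) = 0"
  by (simp add: form_def fun_eq_iff)

lemma form_inject:
  assumes "M \<in> carrier_mat n p" "N \<in> carrier_mat n p" "form n p M = form n p N"
  shows "M = N"
proof (rule eq_matI)
  fix i j assume "i < dim_row N" "j < dim_col N"
  then show "M $$ (i, j) = N $$ (i, j)" using form_unit[of i n j p] assms by (metis carrier_matD)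
qed (use assms in auto)

lemma form_add_left: "form n p M (y + z) x = form n p M y x + form n p M z x"
  unfolding form_def sum.distrib[symmetric] by (simp only: plus_fun_apply distrib_right)

lemma form_add_right: "form n p M y (x + w) = form n p M y x + form n p M y w"
  unfolding form_def sum.distrib[symmetric] by (simp only: plus_fun_apply distrib_left)

lemma form_mult_vec:
  assumes "M \<in> carrier_mat n p"
  shows "form n p M y x = (\<Sum>i<n. y i * (M *\<^sub>v vec p x) $ i)"
  unfolding form_def using assms
  by (intro sum.cong) (simp_all add: scalar_prod_def sum_distrib_left mult.assoc atLeast0LessThan)

lemma minor3_sum_of_two_products:
  assumes "\<And>y x. C y x = f y * g x + f' y * g' x"
  shows "minor3 C y1 y2 y3 x1 x2 x3 = 0"
  unfolding minor3_def assms by (simp only: bit_prop; satx)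

text \<open>The columns are combinations of a maximal independent set of columns, which has at most two members.\<close>

lemma rank_le_2_factorization:
  fixes M :: "bit mat"
  assumes M: "M \<in> carrier_mat n p" and r: "vec_space.rank n M \<le> 2"
  shows "\<exists>a b f g. \<forall>i<n. \<forall>j<p. M $$ (i, j) = a i * f j + b i * g j"
proof -
  interpret vec_space "TYPE(bit)" n .
  have cM: "set (cols M) \<subseteq> carrier_vec n" using cols_dim M by blast
  obtain S where S: "finite S" "maximal S (\<lambda>T. T \<subseteq> set (cols M) \<and> lin_indpt T)"
    using maximal_exists_superset[of "set (cols M)" "\<lambda>T. T \<subseteq> set (cols M) \<and> lin_indpt T" "{}"]
    by (auto simp: lin_dep_def)
  have SM: "S \<subseteq> set (cols M)" "lin_indpt S" using S(2) by (simp_all add: maximal_def)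
  have Sc: "S \<subseteq> carrier_vec n" using SM cM by blast
  have "card S \<le> 2" using rank_card_indpt[OF M S(2)] r by simp
  have "\<exists>h. \<forall>i<n. M $$ (i, j) = (\<Sum>v\<in>S. h v * v $ i)" if j: "j < p" for j
  proof -
    have c: "col M j \<in> set (cols M)" using j M by (simp add: cols_def)
    have "col M j \<in> span S"
    proof (cases "col M j \<in> S")
      case True
      then show ?thesis using in_own_span[OF Sc] by blast
    next
      case False
      then have "lin_dep (S \<union> {col M j})" using S(2) c SM unfolding maximal_def by blast
      then show ?thesis using lin_dep_iff_in_span[OF Sc SM(2) _ False] c cM by blast
    qed
    then obtain h where "col M j = lincomb h S" using finite_span[OF S(1) Sc] by blast
    then have "M $$ (i, j) = (\<Sum>v\<in>S. h v * v $ i)" if "i < n" for i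
      using lincomb_index[OF that Sc, of h] that j M by (metis carrier_matD index_col)
    then show ?thesis by blast
  qed
  then obtain h where h: "\<And>i j. i < n \<Longrightarrow> j < p \<Longrightarrow> M $$ (i, j) = (\<Sum>v\<in>S. h j v * v $ i)"
    by metis
  from \<open>card S \<le> 2\<close> consider "card S = 0" | "card S = 1" | "card S = 2" by linarith
  then obtain s t c where sum: "\<And>g :: bit vec \<Rightarrow> bit. (\<Sum>v\<in>S. g v) = c * g s + (if s = t then 0 else g t)"
  proof cases
    case 1
    then have "S = {}" using S(1) by simp
    then show thesis using that[of 0 undefined undefined] by simp
  next
    case 2
    then obtain s where "S = {s}" by (metis card_1_singletonE)
    then show thesis using that[of 1 s s] by simp
  next
    case 3
    then obtain s t where "S = {s, t}" "s \<noteq> t" by (metis card_2_iff)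
    then show thesis using that[of 1 s t] by simp
  qed
  show ?thesis
  proof (intro exI allI impI)
    fix i j assume "i < n" "j < p"
    then show "M $$ (i, j) = c * (s $ i) * h j s + (if s = t then 0 else t $ i) * h j t"
      using h[of i j] sum[of "\<lambda>v. h j v * v $ i"] by (simp add: ac_simps)
  qed
qed

lemma rank_le_1_of_minors:
  fixes M :: "bit mat"
  assumes M: "M \<in> carrier_mat n p"
    and minors: "\<And>i i' j j'. i < n \<Longrightarrow> i' < n \<Longrightarrow> j < p \<Longrightarrow> j' < p \<Longrightarrow>
      M $$ (i, j) * M $$ (i', j') = M $$ (i, j') * M $$ (i', j)"
  shows "vec_space.rank n M \<le> 1"
proof -
  interpret vec_space "TYPE(bit)" n .
  show ?thesis
  proof (cases "\<exists>i<n. \<exists>j<p. M $$ (i, j) = 1")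
    case True
    then obtain i j where ij: "i < n" "j < p" "M $$ (i, j) = 1" by blast
    show ?thesis
    proof (rule rank_le_1_product_entries[OF M])
      fix r c assume "r < dim_row M" "c < dim_col M"
      then show "M $$ (r, c) = M $$ (r, j) * M $$ (i, c)" using minors[of r i c j] M ij by auto
    qed
  next
    case False
    then have "M = 0\<^sub>m n p" using M by (intro eq_matI) auto
    then show ?thesis using rank_0I by simp
  qed
qed

lemma mat_mult_entry:
  assumes "M \<in> carrier_mat m n" "N \<in> carrier_mat n q" "r < m" "s < q"
  shows "(M * N) $$ (r, s) = (\<Sum>i<n. M $$ (r, i) * N $$ (i, s))"
  using assms by (auto simp: scalar_prod_def atLeast0LessThan intro!: sum.cong)

lemma GL_of_left_inverse:
  fixes P :: "bit mat"
  assumes "P \<in> carrier_mat n n" "L \<in> carrier_mat n n" "L * P = 1\<^sub>m n"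
  shows "P \<in> GL n"
  using mat_mult_left_right_inverse[OF assms(2,1,3)] assms
  unfolding GL_def invertible_mat_def inverts_mat_def by auto

lemma GL_transpose:
  fixes P :: "bit mat"
  assumes "P \<in> GL n" shows "P\<^sup>T \<in> GL n"
proof -
  have P: "P \<in> carrier_mat n n" using assms by (simp add: GL_def)
  obtain L where L: "P * L = 1\<^sub>m n" "L * P = 1\<^sub>m (dim_row L)"
    using assms P unfolding GL_def invertible_mat_def inverts_mat_def by auto
  have "dim_col L = n" using L(1) by (metis index_mult_mat(3) index_one_mat(3))
  moreover have "dim_row L = n" using L(2) P by (metis carrier_matD(2) index_mult_mat(3) index_one_mat(3))
  ultimately have Lc: "L \<in> carrier_mat n n" by auto
  have "L\<^sup>T * P\<^sup>T = (P * L)\<^sup>T" using transpose_mult[OF P Lc] by simp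
  then show ?thesis using GL_of_left_inverse[of "P\<^sup>T" n "L\<^sup>T"] P Lc L(1) by simp
qed

lemma one_mem_GL: "1\<^sub>m n \<in> (GL n :: bit mat set)"
  by (rule GL_of_left_inverse[of _ _ "1\<^sub>m n"]) auto

text \<open>The functional \<open>w\<close> is part of a dual basis: \<open>L\<close> has \<open>w\<close> as its last row, and its other rows are
the coordinates other than \<open>k\<close>, with the last coordinate put in the place of \<open>k\<close>.  All columns of
the inverse \<open>Q\<close> except the last lie in the kernel of \<open>w\<close>.\<close>

lemma hyperplane_basis:
  fixes w :: "nat \<Rightarrow> bit"
  assumes k: "k < p" "w k = 1"
  shows "\<exists>Q\<in>GL p. \<forall>l<p - 1. (\<Sum>j<p. w j * Q $$ (j, l)) = 0"
proof -
  define \<tau> where "\<tau> l = (if l = k then p - 1 else l)" for l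
  define Q where "Q = mat p p (\<lambda>(j, l). if l = p - 1 then (if j = k then 1 else 0)
    else (if j = \<tau> l then 1 else 0) + (if j = k then w (\<tau> l) else 0))"
  define L where "L = mat p p (\<lambda>(l, j). if l = p - 1 then w j else if j = \<tau> l then 1 else 0)"
  have \<tau>: "\<tau> l < p" "\<tau> l \<noteq> k" if "l < p - 1" for l
    using that k by (auto simp: \<tau>_def)
  have \<tau>_inj: "\<tau> l = \<tau> m \<longleftrightarrow> l = m" if "l < p - 1" "m < p - 1" for l m
    using that by (auto simp: \<tau>_def)
  have orth: "(\<Sum>j<p. w j * Q $$ (j, l)) = 0" if "l < p - 1" for l
  proof -
    have "(\<Sum>j<p. w j * Q $$ (j, l)) =
        (\<Sum>j<p. (if j = \<tau> l then w j else 0) + (if j = k then w j * w (\<tau> l) else 0))"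
      using that by (intro sum.cong) (auto simp: Q_def distrib_left)
    also have "\<dots> = w (\<tau> l) + w k * w (\<tau> l)"
      using \<tau>[OF that] k by (simp add: sum.distrib)
    finally show ?thesis using k by (simp add: bit_add_self)
  qed
  have "L * Q = 1\<^sub>m p"
  proof (rule eq_matI)
    fix l m assume "l < dim_row (1\<^sub>m p :: bit mat)" "m < dim_col (1\<^sub>m p :: bit mat)"
    then have lm: "l < p" "m < p" by auto
    have entry: "(L * Q) $$ (l, m) = (\<Sum>j<p. L $$ (l, j) * Q $$ (j, m))"
      by (rule mat_mult_entry[OF _ _ lm]) (simp_all add: L_def Q_def)
    show "(L * Q) $$ (l, m) = 1\<^sub>m p $$ (l, m)"
    proof (cases "l = p - 1")
      case True
      have "(L * Q) $$ (l, m) = (\<Sum>j<p. w j * Q $$ (j, m))"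
        unfolding entry using lm True by (intro sum.cong) (auto simp: L_def)
      also have "\<dots> = (if m = p - 1 then 1 else 0)"
      proof (cases "m = p - 1")
        case True
        have "(\<Sum>j<p. w j * Q $$ (j, m)) = (\<Sum>j<p. if j = k then w j else 0)"
          using lm True by (intro sum.cong) (auto simp: Q_def)
        then show ?thesis using k True by simp
      next
        case False
        then show ?thesis using orth[of m] lm by simp
      qed
      finally show ?thesis using lm True by auto
    next
      case False
      then have l: "l < p - 1" using lm by simp
      have "(L * Q) $$ (l, m) = (\<Sum>j<p. if j = \<tau> l then Q $$ (j, m) else 0)"
        unfolding entry using lm False by (intro sum.cong) (auto simp: L_def)
      also have "\<dots> = Q $$ (\<tau> l, m)" using \<tau>[OF l] by simp
      also have "\<dots> = 1\<^sub>m p $$ (l, m)"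
        using \<tau>[OF l] \<tau>_inj[OF l, of m] lm l by (auto simp: Q_def)
      finally show ?thesis .
    qed
  qed (auto simp: L_def Q_def)
  then have "Q \<in> GL p" by (intro GL_of_left_inverse[of Q p L]) (auto simp: L_def Q_def)
  then show ?thesis using orth by blast
qed

lemma triple_product_entry:
  fixes M :: "bit mat"
  assumes "P \<in> carrier_mat m n" "M \<in> carrier_mat n p" "Q \<in> carrier_mat p q" "r < m" "s < q"
  shows "(P * M * Q) $$ (r, s) = form n p M (\<lambda>i. P $$ (r, i)) (\<lambda>j. Q $$ (j, s))"
proof -
  have "P * M \<in> carrier_mat m p" using assms by auto
  then have "(P * M * Q) $$ (r, s) = (\<Sum>j<p. (\<Sum>i<n. P $$ (r, i) * M $$ (i, j)) * Q $$ (j, s))"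
    using mat_mult_entry[of "P * M" m p Q q r s] mat_mult_entry[OF assms(1,2,4)] assms
    by simp
  also have "\<dots> = (\<Sum>j<p. \<Sum>i<n. P $$ (r, i) * M $$ (i, j) * Q $$ (j, s))"
    by (simp add: sum_distrib_right)
  also have "\<dots> = form n p M (\<lambda>i. P $$ (r, i)) (\<lambda>j. Q $$ (j, s))"
    unfolding form_def by (rule sum.swap)
  finally show ?thesis .
qed

text \<open>Counting the vectors of the space over two elements shows that a basis with three members forces
\<open>2 ^ n = 2 ^ 3\<close>; expanding the unit vectors gives the inverse of the matrix with these rows.\<close>

lemma basis_of_three:
  fixes y :: "nat \<Rightarrow> nat \<Rightarrow> bit"
  assumes span: "\<And>z :: nat \<Rightarrow> bit. \<exists>a b c. \<forall>i<n. z i = a * y 0 i + b * y 1 i + c * y 2 i"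
    and indep: "\<And>a b c. (\<And>i. i < n \<Longrightarrow> a * y 0 i + b * y 1 i + c * y 2 i = 0) \<Longrightarrow> a = 0 \<and> b = 0 \<and> c = 0"
  shows "n = 3" and "mat 3 3 (\<lambda>(r, i). y r i) \<in> GL 3"
proof -
  let ?B = "UNIV :: bit set"
  have bits: "?B = {0, 1}" by (auto intro: bit_not_zero_iff[THEN iffD1])
  define \<Phi> where "\<Phi> t = (case t of (a, b, c) \<Rightarrow>
    restrict (\<lambda>i. a * y 0 i + b * y 1 i + c * y 2 i) {..<n})" for t
  have "bij_betw \<Phi> (?B \<times> ?B \<times> ?B) ({..<n} \<rightarrow>\<^sub>E ?B)"
  proof (rule bij_betwI')
    fix s t assume "s \<in> ?B \<times> ?B \<times> ?B" "t \<in> ?B \<times> ?B \<times> ?B"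
    obtain a b c a' b' c' where st: "s = (a, b, c)" "t = (a', b', c')" by (metis prod_cases3)
    show "\<Phi> s = \<Phi> t \<longleftrightarrow> s = t"
    proof
      assume eq: "\<Phi> s = \<Phi> t"
      have "(a + a') * y 0 i + (b + b') * y 1 i + (c + c') * y 2 i = 0" if "i < n" for i
      proof -
        have "\<Phi> s i = \<Phi> t i" using eq by simp
        then show ?thesis using that unfolding \<Phi>_def st
          by (simp only: case_prod_conv restrict_apply lessThan_iff if_True bit_prop; satx)
      qed
      then have "a + a' = 0 \<and> b + b' = 0 \<and> c + c' = 0" by (rule indep)
      then show "s = t" unfolding st prod.inject by (simp only: bit_prop; satx)
    qed simp
  next
    fix t show "\<Phi> t \<in> {..<n} \<rightarrow>\<^sub>E ?B" by (auto simp: \<Phi>_def split: prod.splits)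
  next
    fix z assume z: "z \<in> {..<n} \<rightarrow>\<^sub>E ?B"
    obtain a b c where "\<forall>i<n. z i = a * y 0 i + b * y 1 i + c * y 2 i" using span by blast
    then have "z = \<Phi> (a, b, c)" using z by (auto simp: \<Phi>_def fun_eq_iff PiE_def extensional_def)
    then show "\<exists>t\<in>?B \<times> ?B \<times> ?B. z = \<Phi> t" by blast
  qed
  then have "card (?B \<times> ?B \<times> ?B) = card ({..<n} \<rightarrow>\<^sub>E ?B)" by (rule bij_betw_same_card)
  moreover have "card ?B = 2" by (simp add: bits)
  ultimately have "(2::nat) ^ 3 = 2 ^ n" by (simp add: card_PiE card_cartesian_product del: UNIV_Times_UNIV)
  then show n: "n = 3" by (metis power_inject_exp one_less_numeral_iff semiring_norm(76))
  have "\<exists>v. \<forall>i<n. unit_fun k i = v 0 * y 0 i + v 1 * y 1 i + v (2::nat) * y 2 i" for k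
  proof -
    obtain a b c where "\<forall>i<n. unit_fun k i = a * y 0 i + b * y 1 i + c * y 2 i" using span by blast
    then show ?thesis by (intro exI[of _ "\<lambda>r. if r = 0 then a else if r = 1 then b else c"]) simp
  qed
  then obtain v where v: "\<And>k i. i < n \<Longrightarrow> unit_fun k i = v k 0 * y 0 i + v k 1 * y 1 i + v k (2::nat) * y 2 i"
    by metis
  show "mat 3 3 (\<lambda>(r, i). y r i) \<in> GL 3"
  proof (rule GL_of_left_inverse)
    show "mat 3 3 (\<lambda>(k, r). v k r) * mat 3 3 (\<lambda>(r, i). y r i) = 1\<^sub>m 3"
    proof (rule eq_matI)
      fix k i assume "k < dim_row (1\<^sub>m 3 :: bit mat)" "i < dim_col (1\<^sub>m 3 :: bit mat)"
      then have ki: "k < 3" "i < 3" by auto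
      have "(mat 3 3 (\<lambda>(k, r). v k r) * mat 3 3 (\<lambda>(r, i). y r i)) $$ (k, i) = (\<Sum>r<3. v k r * y r i)"
        using ki mat_mult_entry[of "mat 3 3 (\<lambda>(k, r). v k r)" 3 3 "mat 3 3 (\<lambda>(r, i). y r i)" 3 k i]
        by simp
      also have "\<dots> = unit_fun k i" using v[of i k] ki n by (simp add: numeral_3_eq_3 numeral_2_eq_2)
      finally show "(mat 3 3 (\<lambda>(k, r). v k r) * mat 3 3 (\<lambda>(r, i). y r i)) $$ (k, i) = 1\<^sub>m 3 $$ (k, i)"
        using ki by (simp add: unit_fun_def)
    qed auto
  qed auto
qed

lemma mat_subspaceD:
  assumes "mat_subspace n p V"
  shows "V \<subseteq> carrier_mat n p" "0\<^sub>m n p \<in> V" "M \<in> V \<Longrightarrow> N \<in> V \<Longrightarrow> M + N \<in> V"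
  using assms unfolding mat_subspace_def VectorSpace.subspace_def submodule_def
  by (auto simp: module_mat_simps)

section \<open>Primitive spaces of matrices\<close>

text \<open>The eight elements listed are the span of \<open>A\<close>, \<open>B\<close> and \<open>D\<close>.\<close>

lemma not_covered_by_three:
  fixes V :: "bit mat set"
  assumes V: "mat_subspace n p V" and dim: "mat_subspace_dim n p V = 4"
    and ABD: "A \<in> V" "B \<in> V" "D \<in> V"
  shows "\<exists>C\<in>V. C \<notin> {0\<^sub>m n p, A, B, A + B, D, A + D, B + D, A + B + D}"
proof (rule ccontr)
  assume "\<not> ?thesis"
  then have cover: "V \<subseteq> {0\<^sub>m n p, A, B, A + B, D, A + D, B + D, A + B + D}" by blast
  interpret W: vectorspace class_ring "(module_mat TYPE(bit) n p)\<lparr>carrier := V\<rparr>"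
    using V matrix_vs unfolding mat_subspace_def by (intro vectorspace.subspace_is_vs)
  have sub: "{A, B, D} \<subseteq> V" using ABD by simp
  have mem: "A \<in> W.span {A, B, D}" "B \<in> W.span {A, B, D}" "D \<in> W.span {A, B, D}"
    "0\<^sub>m n p \<in> W.span {A, B, D}"
    using W.in_own_span[of "{A, B, D}"] W.span_zero[of "{A, B, D}"] sub by (auto simp: module_mat_simps)
  have add: "M + N \<in> W.span {A, B, D}" if "M \<in> W.span {A, B, D}" "N \<in> W.span {A, B, D}" for M N
    using W.span_add1[of "{A, B, D}" M N] sub that by (simp add: module_mat_simps)
  have "V \<subseteq> W.span {A, B, D}" using cover mem add by blast
  moreover have "W.span {A, B, D} \<subseteq> V" using W.span_is_subset2[of "{A, B, D}"] sub by simp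
  ultimately have "W.dim \<le> card {A, B, D}" using sub by (intro W.gen_ge_dim) auto
  also have "\<dots> \<le> 3" by (simp add: card_insert_if)
  finally show False using dim unfolding mat_subspace_dim_def by simp
qed

text \<open>The factorization of a matrix of rank at most \<open>2\<close> carries over to its form, which makes the minors
of order \<open>3\<close> vanish; on unit vectors, the minors of order \<open>2\<close> are those of the matrix.\<close>

lemma rank2_forms_of_matrices:
  fixes V :: "bit mat set"
  assumes V: "mat_subspace n p V" and dim: "mat_subspace_dim n p V = 4"
    and rank: "\<forall>M\<in>V. M \<noteq> 0\<^sub>m n p \<longrightarrow> vec_space.rank n M = 2"
  shows "rank2_forms (form n p ` V)"
proof
  note VD = mat_subspaceD[OF V]
  show "0 \<in> form n p ` V" using VD(2) form_zero by (metis image_eqI)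
  fix C assume "C \<in> form n p ` V"
  then obtain M where M: "M \<in> V" "C = form n p M" by blast
  have Mc: "M \<in> carrier_mat n p" using M VD by blast
  show "C (y + z) x = C y x + C z x" for y z x by (simp only: M form_add_left)
  show "C y (x + w) = C y x + C y w" for y x w by (simp only: M form_add_right)
  show "C + D \<in> form n p ` V" if "D \<in> form n p ` V" for D
  proof -
    obtain N where N: "N \<in> V" "D = form n p N" using \<open>D \<in> form n p ` V\<close> by blast
    then have "C + D = form n p (M + N)" using form_add[OF Mc, of N] M N VD(1) by auto
    then show ?thesis using VD(3) M N by blast
  qed
  show "minor3 C y1 y2 y3 x1 x2 x3 = 0" for y1 y2 y3 x1 x2 x3
  proof -
    interpret vec_space "TYPE(bit)" n .
    have "vec_space.rank n M \<le> 2" using rank M(1) rank_0I[of p] by (cases "M = 0\<^sub>m n p") auto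
    then obtain a b f g where
      fac: "\<And>i j. i < n \<Longrightarrow> j < p \<Longrightarrow> M $$ (i, j) = a i * f j + b i * g j"
      using rank_le_2_factorization[OF Mc] by blast
    have "C y x = (\<Sum>i<n. y i * a i) * (\<Sum>j<p. f j * x j) + (\<Sum>i<n. y i * b i) * (\<Sum>j<p. g j * x j)"
      for y x
      unfolding M form_def sum_product sum.distrib[symmetric]
      by (intro sum.cong) (simp_all add: fac algebra_simps)
    then show ?thesis
      by (rule minor3_sum_of_two_products[where f = "\<lambda>y. \<Sum>i<n. y i * a i"
          and g = "\<lambda>x. \<Sum>j<p. f j * x j" and f' = "\<lambda>y. \<Sum>i<n. y i * b i"
          and g' = "\<lambda>x. \<Sum>j<p. g j * x j"])
  qed
  show "\<exists>y1 y2 x1 x2. minor2 C y1 y2 x1 x2 = 1" if C0: "C \<noteq> 0"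
  proof (rule ccontr)
    assume "\<not> ?thesis"
    then have m: "minor2 C y1 y2 x1 x2 = 0" for y1 y2 x1 x2 by (metis bit_not_one_iff)
    have "M $$ (i, j) * M $$ (i', j') = M $$ (i, j') * M $$ (i', j)"
      if "i < n" "i' < n" "j < p" "j' < p" for i i' j j'
      using m[of "unit_fun i" "unit_fun i'" "unit_fun j" "unit_fun j'"] that
      unfolding minor2_def M by (simp only: form_unit bit_prop; satx)
    then have "vec_space.rank n M \<le> 1" by (rule rank_le_1_of_minors[OF Mc])
    moreover have "M \<noteq> 0\<^sub>m n p" using C0 form_zero unfolding M by auto
    ultimately show False using rank M(1) by force
  qed
next
  note VD = mat_subspaceD[OF V]
  fix A B D assume "A \<in> form n p ` V" "B \<in> form n p ` V" "D \<in> form n p ` V"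
  then obtain A' B' D' where *: "A' \<in> V" "B' \<in> V" "D' \<in> V"
    and ABD: "A = form n p A'" "B = form n p B'" "D = form n p D'" by blast
  let ?S = "{0\<^sub>m n p, A', B', A' + B', D', A' + D', B' + D', A' + B' + D'}"
  obtain C where C: "C \<in> V" "C \<notin> ?S" using not_covered_by_three[OF V dim *] by blast
  have S: "?S \<subseteq> V" using * VD(2) by (auto intro!: VD(3))
  have c: "A' \<in> carrier_mat n p" "B' \<in> carrier_mat n p" "D' \<in> carrier_mat n p"
    "A' + B' \<in> carrier_mat n p" using * VD(1) by auto
  have "form n p C \<notin> form n p ` ?S"
  proof
    assume "form n p C \<in> form n p ` ?S"
    then obtain N where N: "N \<in> ?S" "form n p C = form n p N" by blast
    then have "C = N" using form_inject[of C n p N] S C(1) VD(1) by blast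
    then show False using N C by blast
  qed
  also have "form n p ` ?S = {0, A, B, A + B, D, A + D, B + D, A + B + D}"
    unfolding ABD image_insert image_empty form_zero
      form_add[OF c(1,2)] form_add[OF c(1,3)] form_add[OF c(2,3)] form_add[OF c(4,3)] ..
  finally show "\<exists>C\<in>form n p ` V. C \<notin> {0, A, B, A + B, D, A + D, B + D, A + B + D}"
    using C(1) by blast
qed

lemma upper_rank_le:
  assumes "W \<noteq> {}" "\<And>M. M \<in> W \<Longrightarrow> vec_space.rank n M \<le> k"
  shows "upper_rank n W \<le> k"
proof -
  have "vec_space.rank n ` W \<subseteq> {..k}" using assms(2) by auto
  then have "finite (vec_space.rank n ` W)" by (rule finite_subset) simp
  then show ?thesis unfolding upper_rank_def using assms by (subst Max_le_iff) auto
qed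

lemma upper_rank_eq_2:
  fixes V :: "bit mat set"
  assumes V: "mat_subspace n p V" and dim: "mat_subspace_dim n p V = 4"
    and rank: "\<forall>M\<in>V. M \<noteq> 0\<^sub>m n p \<longrightarrow> vec_space.rank n M = 2"
  shows "upper_rank n V = 2"
proof -
  interpret vec_space "TYPE(bit)" n .
  obtain M where M: "M \<in> V" "M \<noteq> 0\<^sub>m n p"
    using not_covered_by_three[OF V dim] mat_subspaceD(2)[OF V] by blast
  have ranks: "vec_space.rank n ` V \<subseteq> {0, 2}" using rank rank_0I[of p] by force
  then have "finite (vec_space.rank n ` V)" by (rule finite_subset) simp
  moreover have "2 \<in> vec_space.rank n ` V" using M rank by force
  ultimately show ?thesis unfolding upper_rank_def using ranks by (intro Max_eqI) auto
qed

lemma form_row_functional: "form n p M u x = (\<Sum>j<p. (\<Sum>i<n. u i * M $$ (i, j)) * x j)"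
  unfolding form_def sum_distrib_right by (rule sum.swap)

lemma form_col_functional: "form n p M y v = (\<Sum>i<n. (\<Sum>j<p. M $$ (i, j) * v j) * y i)"
  unfolding form_def sum_distrib_right by (intro sum.cong refl) (simp add: ac_simps)

text \<open>A hyperplane on which all forms have rank at most \<open>1\<close> can be moved to the span of the first \<open>p - 1\<close>
columns, contradicting the third condition for primitivity.\<close>

lemma not_collapses_cols:
  fixes V :: "bit mat set"
  assumes V: "mat_subspace n p V" and prim: "primitive_space n p V" and r: "upper_rank n V = 2"
  shows "\<not> collapses (form n p ` V)"
proof
  note VD = mat_subspaceD[OF V]
  assume "collapses (form n p ` V)"
  then obtain A u x where A: "A \<in> V" "form n p A u x \<noteq> 0"
    and low: "\<And>M y y' x x'. M \<in> V \<Longrightarrow> form n p A u x = 0 \<Longrightarrow> form n p A u x' = 0 \<Longrightarrow>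
      minor2 (form n p M) y y' x x' = 0"
    unfolding collapses_def by blast
  define w where "w j = (\<Sum>i<n. u i * A $$ (i, j))" for j
  have wA: "form n p A u x = (\<Sum>j<p. w j * x j)" for x
    unfolding w_def by (rule form_row_functional)
  have "\<exists>k<p. w k \<noteq> 0"
  proof (rule ccontr)
    assume "\<not> ?thesis"
    then show False using A(2) unfolding wA by simp
  qed
  then obtain k where k: "k < p" "w k = 1" by auto
  obtain Q where Q: "Q \<in> GL p" "\<And>l. l < p - 1 \<Longrightarrow> (\<Sum>j<p. w j * Q $$ (j, l)) = 0"
    using hyperplane_basis[where w = w, OF k] by blast
  have Qc: "Q \<in> carrier_mat p p" using Q by (simp add: GL_def)
  define T where "T = (\<lambda>M. 1\<^sub>m n * M * Q) ` V"
  have "equivalent_spaces n p V T"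
    unfolding equivalent_spaces_def T_def using one_mem_GL Q(1) by blast
  moreover have "upper_rank n (drop_last_col ` T) \<le> 1"
  proof (rule upper_rank_le)
    show "drop_last_col ` T \<noteq> {}" using VD(2) by (auto simp: T_def)
    fix N assume "N \<in> drop_last_col ` T"
    then obtain M where M: "M \<in> V" "N = drop_last_col (1\<^sub>m n * M * Q)" by (auto simp: T_def)
    have Mc: "M \<in> carrier_mat n p" using M VD by blast
    have dims: "dim_row (1\<^sub>m n * M * Q) = n" "dim_col (1\<^sub>m n * M * Q) = p" using Mc Qc by auto
    have entry: "N $$ (i, l) = form n p M (\<lambda>k. 1\<^sub>m n $$ (i, k)) (\<lambda>j. Q $$ (j, l))"
      if "i < n" "l < p - 1" for i l
      using that triple_product_entry[OF one_carrier_mat Mc Qc, of i l] dims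
      unfolding M(2) drop_last_col_def by simp
    show "vec_space.rank n N \<le> 1"
    proof (rule rank_le_1_of_minors)
      show "N \<in> carrier_mat n (p - 1)" unfolding M(2) drop_last_col_def dims by simp
      fix i i' l l' assume *: "i < n" "i' < n" "l < p - 1" "l' < p - 1"
      have "form n p A u (\<lambda>j. Q $$ (j, l)) = 0" "form n p A u (\<lambda>j. Q $$ (j, l')) = 0"
        unfolding wA using Q(2) * by blast+
      from low[OF M(1) this, of "\<lambda>k. 1\<^sub>m n $$ (i, k)" "\<lambda>k. 1\<^sub>m n $$ (i', k)"]
      show "N $$ (i, l) * N $$ (i', l') = N $$ (i, l') * N $$ (i', l)"
        unfolding minor2_def entry[OF *(1,3)] entry[OF *(2,4)] entry[OF *(1,4)] entry[OF *(2,3)]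
        by (simp only: bit_prop; satx)
    qed
  qed
  ultimately show False using prim k r unfolding primitive_space_def by fastforce
qed

text \<open>The same argument with rows, contradicting the fourth condition.\<close>

lemma not_collapses_rows:
  fixes V :: "bit mat set"
  assumes V: "mat_subspace n p V" and prim: "primitive_space n p V" and r: "upper_rank n V = 2"
  shows "\<not> collapses ((\<lambda>C x y. C y x) ` form n p ` V)"
proof
  note VD = mat_subspaceD[OF V]
  assume "collapses ((\<lambda>C x y. C y x) ` form n p ` V)"
  then obtain A v y where A: "A \<in> V" "form n p A y v \<noteq> 0"
    and low: "\<And>M y y' x x'. M \<in> V \<Longrightarrow> form n p A y v = 0 \<Longrightarrow> form n p A y' v = 0 \<Longrightarrow>
      minor2 (\<lambda>x y. form n p M y x) x x' y y' = 0"
    unfolding collapses_def by blast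
  define w where "w i = (\<Sum>j<p. A $$ (i, j) * v j)" for i
  have wA: "form n p A y v = (\<Sum>i<n. w i * y i)" for y
    unfolding w_def by (rule form_col_functional)
  have "\<exists>k<n. w k \<noteq> 0"
  proof (rule ccontr)
    assume "\<not> ?thesis"
    then show False using A(2) unfolding wA by simp
  qed
  then obtain k where k: "k < n" "w k = 1" by auto
  obtain Q where Q: "Q \<in> GL n" "\<And>l. l < n - 1 \<Longrightarrow> (\<Sum>i<n. w i * Q $$ (i, l)) = 0"
    using hyperplane_basis[where w = w, OF k] by blast
  have Qc: "Q \<in> carrier_mat n n" using Q by (simp add: GL_def)
  have QT: "Q\<^sup>T \<in> carrier_mat n n" using Qc by simp
  define T where "T = (\<lambda>M. Q\<^sup>T * M * 1\<^sub>m p) ` V"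
  have "equivalent_spaces n p V T"
    unfolding equivalent_spaces_def T_def using one_mem_GL GL_transpose[OF Q(1)] by blast
  moreover have "upper_rank (n - 1) (drop_last_row ` T) \<le> 1"
  proof (rule upper_rank_le)
    show "drop_last_row ` T \<noteq> {}" using VD(2) by (auto simp: T_def)
    fix N assume "N \<in> drop_last_row ` T"
    then obtain M where M: "M \<in> V" "N = drop_last_row (Q\<^sup>T * M * 1\<^sub>m p)" by (auto simp: T_def)
    have Mc: "M \<in> carrier_mat n p" using M VD by blast
    have dims: "dim_row (Q\<^sup>T * M * 1\<^sub>m p) = n" "dim_col (Q\<^sup>T * M * 1\<^sub>m p) = p" using Mc Qc by auto
    have entry: "N $$ (l, j) = form n p M (\<lambda>i. Q\<^sup>T $$ (l, i)) (\<lambda>k. 1\<^sub>m p $$ (k, j))"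
      if "l < n - 1" "j < p" for l j
      using that triple_product_entry[OF QT Mc one_carrier_mat, of l j] dims
      unfolding M(2) drop_last_row_def by simp
    show "vec_space.rank (n - 1) N \<le> 1"
    proof (rule rank_le_1_of_minors)
      show "N \<in> carrier_mat (n - 1) p" unfolding M(2) drop_last_row_def dims by simp
      fix l l' j j' assume *: "l < n - 1" "l' < n - 1" "j < p" "j' < p"
      have "form n p A (\<lambda>i. Q\<^sup>T $$ (l, i)) v = 0" if l: "l < n - 1" for l
      proof -
        have "form n p A (\<lambda>i. Q\<^sup>T $$ (l, i)) v = (\<Sum>i<n. w i * Q $$ (i, l))"
          unfolding wA using l Qc by (intro sum.cong) auto
        then show ?thesis using Q(2)[OF l] by simp
      qed
      from low[OF M(1) this[OF *(1)] this[OF *(2)], of "\<lambda>k. 1\<^sub>m p $$ (k, j)" "\<lambda>k. 1\<^sub>m p $$ (k, j')"]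
      show "N $$ (l, j) * N $$ (l', j') = N $$ (l, j') * N $$ (l', j)"
        unfolding minor2_def entry[OF *(1,3)] entry[OF *(2,4)] entry[OF *(1,4)] entry[OF *(2,3)]
        by (simp only: bit_prop; satx)
    qed
  qed
  ultimately show False using prim k r unfolding primitive_space_def by fastforce
qed

text \<open>The vectors annihilated by \<open>y\<close> form a subspace that contains all images, hence everything by the
second condition for primitivity.\<close>

lemma left_kernel_trivial:
  fixes V :: "bit mat set"
  assumes V: "mat_subspace n p V" and prim: "primitive_space n p V"
    and y: "\<And>M x. M \<in> V \<Longrightarrow> form n p M y x = 0" and i: "i < n"
  shows "y i = 0"
proof -
  interpret vec_space "TYPE(bit)" n .
  let ?G = "\<Union>M\<in>V. (\<lambda>x. M *\<^sub>v x) ` carrier_vec p"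
  define N where "N = {v \<in> carrier_vec n. (\<Sum>i<n. y i * v $ i) = 0}"
  have "submodule class_ring N (module_vec TYPE(bit) n)"
    by unfold_locales (auto simp: N_def module_vec_simps class_ring_simps distrib_left sum.distrib
        sum_distrib_left[symmetric] mult.left_commute)
  moreover have "?G \<subseteq> N"
  proof
    fix v assume "v \<in> ?G"
    then obtain M x where M: "M \<in> V" "x \<in> carrier_vec p" "v = M *\<^sub>v x" by blast
    have Mc: "M \<in> carrier_mat n p" using M mat_subspaceD[OF V] by blast
    have "vec p (\<lambda>j. x $ j) = x" using M(2) by auto
    then show "v \<in> N" using y[OF M(1), of "\<lambda>j. x $ j"] M Mc
      unfolding N_def form_mult_vec[OF Mc] by auto
  qed
  ultimately have "span ?G \<subseteq> N" by (intro span_is_subset)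
  then have "unit_vec n i \<in> N" using prim unit_vec_carrier[of n i] unfolding primitive_space_def by blast
  then have "(\<Sum>k<n. y k * unit_vec n i $ k) = 0" unfolding N_def by blast
  moreover have "(\<Sum>k<n. y k * unit_vec n i $ k) = (\<Sum>k<n. if k = i then y k else 0)"
    using i by (intro sum.cong) auto
  ultimately show ?thesis using i by simp
qed

lemma right_kernel_trivial:
  fixes V :: "bit mat set"
  assumes V: "mat_subspace n p V" and prim: "primitive_space n p V"
    and x: "\<And>M y. M \<in> V \<Longrightarrow> form n p M y x = 0" and j: "j < p"
  shows "x j = 0"
proof (rule ccontr)
  assume "x j \<noteq> 0"
  then have "vec p x \<noteq> 0\<^sub>v p" using j by (metis index_vec index_zero_vec(1))
  moreover have "vec p x \<in> mat_kernel M" if M: "M \<in> V" for M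
  proof (rule mat_kernelI)
    show Mc: "M \<in> carrier_mat n p" using M mat_subspaceD[OF V] by blast
    show "M *\<^sub>v vec p x = 0\<^sub>v n"
    proof (rule eq_vecI)
      fix i assume "i < dim_vec (0\<^sub>v n :: bit vec)"
      then have i: "i < n" by simp
      have "form n p M (unit_fun i) x = (\<Sum>k<n. if k = i then (M *\<^sub>v vec p x) $ k else 0)"
        unfolding form_mult_vec[OF Mc] by (intro sum.cong) (auto simp: unit_fun_def)
      then have "(\<Sum>k<n. if k = i then (M *\<^sub>v vec p x) $ k else 0) = 0"
        using x[OF M] by simp
      then show "(M *\<^sub>v vec p x) $ i = 0\<^sub>v n $ i" using i by simp
    qed (use Mc in auto)
  qed simp
  ultimately show False using prim unfolding primitive_space_def by (metis vec_carrier)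
qed

text \<open>Five linear equations between the entries describe \<^const>\<open>V3_F2\<close>, with \<open>a\<close>, \<open>b\<close>, \<open>c\<close>, \<open>d\<close> in the
places \<open>(0, 1)\<close>, \<open>(1, 2)\<close>, \<open>(1, 0)\<close>, \<open>(2, 1)\<close>.\<close>

lemma V3_entries: 
  "M \<in> V3_F2 \<longleftrightarrow> M \<in> carrier_mat 3 3 \<and> M $$ (0, 0) = 0 \<and> M $$ (1, 1) = 0 \<and> M $$ (2, 2) = 0 \<and>
     M $$ (2, 0) = M $$ (0, 1) + M $$ (1, 2) \<and> M $$ (0, 2) = M $$ (1, 0) + M $$ (2, 1)"
proof
  assume "M \<in> V3_F2"
  then show "M \<in> carrier_mat 3 3 \<and> M $$ (0, 0) = 0 \<and> M $$ (1, 1) = 0 \<and> M $$ (2, 2) = 0 \<and>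
     M $$ (2, 0) = M $$ (0, 1) + M $$ (1, 2) \<and> M $$ (0, 2) = M $$ (1, 0) + M $$ (2, 1)"
    unfolding V3_F2_def by (auto simp: mat_of_rows_list_def)
next
  assume M: "M \<in> carrier_mat 3 3 \<and> M $$ (0, 0) = 0 \<and> M $$ (1, 1) = 0 \<and> M $$ (2, 2) = 0 \<and>
     M $$ (2, 0) = M $$ (0, 1) + M $$ (1, 2) \<and> M $$ (0, 2) = M $$ (1, 0) + M $$ (2, 1)"
  have "M = mat_of_rows_list 3
      [[0, M $$ (0, 1), M $$ (1, 0) + M $$ (2, 1)],
       [M $$ (1, 0), 0, M $$ (1, 2)],
       [M $$ (0, 1) + M $$ (1, 2), M $$ (2, 1), 0]]" (is "_ = ?R")
  proof (rule eq_matI)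
    fix i j assume "i < dim_row ?R" "j < dim_col ?R"
    then have "i \<in> {0, 1, 2}" "j \<in> {0, 1, 2}" by (auto simp: mat_of_rows_list_def)
    then show "M $$ (i, j) = ?R $$ (i, j)" using M by (auto simp: mat_of_rows_list_def)
  qed (use M in \<open>auto simp: mat_of_rows_list_def\<close>)
  then show "M \<in> V3_F2" unfolding V3_F2_def by blast
qed

text \<open>By primitivity there are no common kernels, so the vectors of the frame span both spaces.  They are
independent because the parameters of \<^const>\<open>V3_F2\<close> can be chosen freely; hence they are the rows of
\<open>P\<close> and the columns of \<open>Q\<close> for invertible matrices \<open>P\<close> and \<open>Q\<close>.\<close>

lemma equivalent_of_V3_frame:
  fixes V :: "bit mat set"
  assumes V: "mat_subspace n p V" and prim: "primitive_space n p V"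
    and fr: "V3_frame (form n p ` V) y1 y2 y3 x1 x2 x3"
  shows "n = 3 \<and> p = 3 \<and> equivalent_spaces n p V V3_F2"
proof -
  note VD = mat_subspaceD[OF V]
  define y where "y r = (if r = 0 then y1 else if r = 1 then y2 else y3)" for r :: nat
  define x where "x r = (if r = 0 then x1 else if r = 1 then x2 else x3)" for r :: nat
  have y_simps: "y 0 = y1" "y 1 = y2" "y 2 = y3" "x 0 = x1" "x 1 = x2" "x 2 = x3"
    by (simp_all add: y_def x_def)
  have rel: "form n p M y1 x1 = 0 \<and> form n p M y2 x2 = 0 \<and> form n p M y3 x3 = 0 \<and>
        form n p M y3 x1 = form n p M y1 x2 + form n p M y2 x3 \<and>
        form n p M y1 x3 = form n p M y2 x1 + form n p M y3 x2" if "M \<in> V" for M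
    using fr that unfolding V3_frame_def by blast
  have sur: "\<exists>M\<in>V. form n p M y1 x2 = a \<and> form n p M y2 x3 = b \<and> form n p M y2 x1 = c \<and>
      form n p M y3 x2 = d" for a b c d
    using fr unfolding V3_frame_def by blast
  \<comment> \<open>Two elements whose matrices detect all coefficients of a linear relation.\<close>
  obtain M1 where M1: "M1 \<in> V" "form n p M1 y1 x2 = 1" "form n p M1 y2 x3 = 0"
    "form n p M1 y2 x1 = 0" "form n p M1 y3 x2 = 0" using sur by blast
  obtain M2 where M2: "M2 \<in> V" "form n p M2 y1 x2 = 0" "form n p M2 y2 x3 = 1"
    "form n p M2 y2 x1 = 0" "form n p M2 y3 x2 = 0" using sur by blast
  note fs = rel[OF M1(1)] rel[OF M2(1)] M1(2-) M2(2-)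
  have form_comb_left: "form n p M (\<lambda>i. a * y 0 i + b * y 1 i + c * y 2 i) z =
      a * form n p M y1 z + b * form n p M y2 z + c * form n p M y3 z" for M a b c z
    unfolding form_def y_simps sum_distrib_left sum.distrib[symmetric]
    by (intro sum.cong) (simp_all add: algebra_simps)
  have form_comb_right: "form n p M z (\<lambda>i. a * x 0 i + b * x 1 i + c * x 2 i) =
      a * form n p M z x1 + b * form n p M z x2 + c * form n p M z x3" for M a b c z
    unfolding form_def y_simps sum_distrib_left sum.distrib[symmetric]
    by (intro sum.cong) (simp_all add: algebra_simps)
  have zero_left: "form n p M z w = 0" if "\<And>i. i < n \<Longrightarrow> z i = 0" for M z w
    unfolding form_def using that by simp
  have zero_right: "form n p M w z = 0" if "\<And>j. j < p \<Longrightarrow> z j = 0" for M z w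
    unfolding form_def using that by simp
  have span_left: "\<exists>a b c. \<forall>i<n. z i = a * y 0 i + b * y 1 i + c * y 2 i" for z
  proof -
    obtain a b c where *: "\<And>M w. M \<in> V \<Longrightarrow>
        form n p M z w = a * form n p M y1 w + b * form n p M y2 w + c * form n p M y3 w"
      using fr unfolding V3_frame_def by (metis image_eqI)
    have "(z + (\<lambda>i. a * y 0 i + b * y 1 i + c * y 2 i)) i = 0" if "i < n" for i
      by (rule left_kernel_trivial[OF V prim _ that])
        (simp only: form_add_left form_comb_left * bit_add_self)
    then have "z i = a * y 0 i + b * y 1 i + c * y 2 i" if "i < n" for i
      using that unfolding plus_fun_apply by (metis add.assoc add.right_neutral bit_add_self)
    then show ?thesis by blast
  qed
  have span_right: "\<exists>a b c. \<forall>i<p. z i = a * x 0 i + b * x 1 i + c * x 2 i" for z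
  proof -
    obtain a b c where *: "\<And>M w. M \<in> V \<Longrightarrow>
        form n p M w z = a * form n p M w x1 + b * form n p M w x2 + c * form n p M w x3"
      using fr unfolding V3_frame_def by (metis image_eqI)
    have "(z + (\<lambda>i. a * x 0 i + b * x 1 i + c * x 2 i)) i = 0" if "i < p" for i
      by (rule right_kernel_trivial[OF V prim _ that])
        (simp only: form_add_right form_comb_right * bit_add_self)
    then have "z i = a * x 0 i + b * x 1 i + c * x 2 i" if "i < p" for i
      using that unfolding plus_fun_apply by (metis add.assoc add.right_neutral bit_add_self)
    then show ?thesis by blast
  qed
  have indep_left: "a = 0 \<and> b = 0 \<and> c = 0"
    if "\<And>i. i < n \<Longrightarrow> a * y 0 i + b * y 1 i + c * y 2 i = 0" for a b c
  proof -
    have "a * form n p M y1 w + b * form n p M y2 w + c * form n p M y3 w = 0" for M w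
      unfolding form_comb_left[symmetric] by (rule zero_left) (rule that)
    from this[of M1 x2] this[of M1 x1] this[of M2 x3] this[of M2 x1] show ?thesis by (simp add: fs)
  qed
  have indep_right: "a = 0 \<and> b = 0 \<and> c = 0"
    if "\<And>i. i < p \<Longrightarrow> a * x 0 i + b * x 1 i + c * x 2 i = 0" for a b c
  proof -
    have "a * form n p M w x1 + b * form n p M w x2 + c * form n p M w x3 = 0" for M w
      unfolding form_comb_right[symmetric] by (rule zero_right) (rule that)
    from this[of M1 y1] this[of M1 y3] this[of M2 y2] this[of M2 y3] show ?thesis by (simp add: fs)
  qed
  define P where "P = mat 3 3 (\<lambda>(r, i). y r i)"
  define Q where "Q = (mat 3 3 (\<lambda>(r, i). x r i))\<^sup>T"
  have n: "n = 3" and P: "P \<in> GL 3"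
    unfolding P_def by (rule basis_of_three[OF span_left indep_left]; assumption)+
  have p: "p = 3" and Q: "Q \<in> GL 3"
    unfolding Q_def by (rule basis_of_three(1)[OF span_right indep_right]; assumption)
      (rule GL_transpose, rule basis_of_three(2)[OF span_right indep_right]; assumption)
  have entry: "(P * M * Q) $$ (r, s) = form n p M (y r) (x s)" if "M \<in> V" "r < 3" "s < 3" for M r s
  proof -
    have "(P * M * Q) $$ (r, s) = form 3 3 M (\<lambda>i. P $$ (r, i)) (\<lambda>j. Q $$ (j, s))"
      using that VD(1) n p P Q by (intro triple_product_entry[of P 3 3 M 3 Q 3]) (auto simp: GL_def)
    also have "\<dots> = form n p M (y r) (x s)"
      unfolding form_def n p P_def Q_def using that by (intro sum.cong) auto
    finally show ?thesis .
  qed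
  have carrier: "P * M * Q \<in> carrier_mat 3 3" if "M \<in> V" for M
    using that VD(1) n p P Q by (auto simp: GL_def)
  have "V3_F2 = (\<lambda>M. P * M * Q) ` V"
  proof (intro subset_antisym subsetI)
    fix N assume "N \<in> (\<lambda>M. P * M * Q) ` V"
    then obtain M where M: "M \<in> V" "N = P * M * Q" by blast
    show "N \<in> V3_F2"
      unfolding V3_entries M(2) using carrier[OF M(1)] rel[OF M(1)] by (simp add: entry[OF M(1)] y_def x_def)
  next
    fix N assume N: "N \<in> V3_F2"
    obtain M where M: "M \<in> V" "form n p M y1 x2 = N $$ (0, 1)" "form n p M y2 x3 = N $$ (1, 2)"
      "form n p M y2 x1 = N $$ (1, 0)" "form n p M y3 x2 = N $$ (2, 1)" using sur by blast
    have "N = P * M * Q"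
    proof (rule eq_matI)
      fix r s assume "r < dim_row (P * M * Q)" "s < dim_col (P * M * Q)"
      then have rs: "r < 3" "s < 3" using carrier[OF M(1)] by auto
      then have "r \<in> {0, 1, 2}" "s \<in> {0, 1, 2}" by auto
      then show "N $$ (r, s) = (P * M * Q) $$ (r, s)"
        using N rel[OF M(1)] M(2-) unfolding entry[OF M(1) rs] V3_entries by (auto simp: y_def x_def)
    qed (use N carrier[OF M(1)] in \<open>auto simp: V3_entries\<close>)
    then show "N \<in> (\<lambda>M. P * M * Q) ` V" using M(1) by blast
  qed
  then show ?thesis unfolding equivalent_spaces_def n p using P Q by blast
qed

theorem corollary1p6:
  fixes n p :: nat and V :: "bit mat set"
  assumes "mat_subspace n p V"
    and "primitive_space n p V"
    and "mat_subspace_dim n p V = 4"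
    and "\<forall>M \<in> V. M \<noteq> 0\<^sub>m n p \<longrightarrow> vec_space.rank n M = 2"
  shows "n = 3 \<and> p = 3 \<and> equivalent_spaces n p V V3_F2"
proof -
  interpret rank2_forms "form n p ` V" by (rule rank2_forms_of_matrices[OF assms(1,3,4)])
  note r = upper_rank_eq_2[OF assms(1,3,4)]
  obtain y1 y2 y3 x1 x2 x3 where "V3_frame (form n p ` V) y1 y2 y3 x1 x2 x3"
    using trichotomy not_collapses_cols[OF assms(1,2) r] not_collapses_rows[OF assms(1,2) r] by blast
  then show ?thesis by (rule equivalent_of_V3_frame[OF assms(1,2)])
qed

end
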